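(* Let $b>0$, $\mu>0$ and $\gamma,\nu\in\mathbb{R}$ be fixed with $2\mu-\gamma>\tfrac12$ and $\gamma+\nu\notin\{-1,-3,-5,\ldots\}$. Then, as $a\to+\infty$, $$\sum_{n=1}^\infty\frac{(-1)^{n-1}n^\gamma}{(n^2+a^2)^\mu}J_\nu(nb/a)\sim\frac{a^{-\nu-2\mu}(b/2)^\nu}{\Gamma(1+\nu)}\sum_{k=0}^\infty\frac{(-1)^k(\mu)_k}{k!}\,\zeta(-\omega_k)\,F_k\,\big\{1-2^{1+\omega_k}\big\}\,a^{-2k},$$ where $\omega_k=\gamma+\nu+2k$ and $F_k$ is as defined in the context.
   Context: $J_\nu$ is the Bessel function of the first kind, $\zeta$ the Riemann zeta function, $(\alpha)_n=\Gamma(\alpha+n)/\Gamma(\alpha)$, and $\chi=b^2/4$. The $F_k$ are the polynomials of degree $k$ in $\chi$ $$F_k={}_1F_2\left(\begin{array}{c}-k\\1-\mu-k,\,1+\nu\end{array}\Big|\,\chi\right)=\sum_{j=0}^k\frac{(-k)_j}{(1-\mu-k)_j(1+\nu)_j}\frac{\chi^j}{j!}.$$ If $\nu$ is a negative integer, $F_k/\Gamma(1+\nu)$ is understood as $\sum_{j=0}^k\frac{(-k)_j}{(1-\mu-k)_j\Gamma(1+\nu+j)}\frac{\chi^j}{j!}$. The symbol $\sim$ is in the Poincaré sense: for each $K\ge0$, the left side minus the prefactor times $\sum_{k=0}^{K-1}$ of the series is $O(a^{-\nu-2\mu-2K})$ as $a\to+\infty$, all other parameters fixed. *)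

theory Defs
  imports "HOL-Complex_Analysis.Complex_Analysis" "HOL-Library.Landau_Symbols"
begin

text \<open>
  The Riemann zeta function: the analytic continuation of the Dirichlet series to the plane
  punctured at 1. The two conditions determine it uniquely there, since the punctured plane is
  connected; its value at the pole 1 is left unspecified. At real
  arguments other than 1 it is real.
\<close>

definition zeta :: "complex \<Rightarrow> complex" where
  "zeta = (SOME f. f holomorphic_on (- {1}) \<and>
                   (\<forall>s. Re s > 1 \<longrightarrow> (\<lambda>n. of_nat (Suc n) powr (- s)) sums f s))"

text \<open>
  The Bessel function of the first kind, of arbitrary real order, for a positive argument (the
  real power of \<open>x / 2\<close> is only meaningful there). The function \<^const>\<open>rGamma\<close> is the entire
  function 1/Gamma, so terms at which Gamma has a pole vanish.
\<close>

definition bessel_J :: "real \<Rightarrow> real \<Rightarrow> real" where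
  "bessel_J \<nu> x =
     (\<Sum>m. (-1) ^ m * rGamma (\<nu> + real m + 1) / fact m * (x / 2) powr (\<nu> + 2 * real m))"

definition F :: "real \<Rightarrow> real \<Rightarrow> real \<Rightarrow> nat \<Rightarrow> real" where
  "F \<mu> \<nu> x k =
     (\<Sum>j\<le>k. pochhammer (- real k) j /
             (pochhammer (1 - \<mu> - real k) j * pochhammer (1 + \<nu>) j) * (x ^ j / fact j))"

text \<open>
  The quotient of \<^const>\<open>F\<close> by Gamma(1 + nu). When nu is a negative integer, neither
  \<^const>\<open>F\<close> nor the quotient need make sense by itself, and the quotient is understood
  termwise, with Gamma(1 + nu) absorbed into the Pochhammer symbol.
\<close>

definition F_div_Gamma :: "real \<Rightarrow> real \<Rightarrow> real \<Rightarrow> nat \<Rightarrow> real" where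
  "F_div_Gamma \<mu> \<nu> x k =
     (if \<nu> \<in> \<int> \<and> \<nu> < 0
      then (\<Sum>j\<le>k. pochhammer (- real k) j / pochhammer (1 - \<mu> - real k) j *
                   rGamma (1 + \<nu> + real j) * (x ^ j / fact j))
      else F \<mu> \<nu> x k / Gamma (1 + \<nu>))"

end

theory Submission imports Defs "HOL-Real_Asymp.Real_Asymp" begin

text \<open>
  Pulling out powers of \<open>a\<close> turns the sum into an alternating sum
  \<open>\<Sum>n. (-1)^(n-1) f(n/a)\<close> of samples of one function,
  \<open>f x = x^\<gamma> (1 + x^2)^(-\<mu>) J_\<nu>(b x)\<close>. Near 0 it has a convergent expansion
  \<open>f x = \<Sum>k. H_k x^(\<omega>_k)\<close>, and termwise the alternating sum of \<open>n^\<omega>\<close> is the eta value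
  \<open>(1 - 2^(1 + \<omega>)) \<zeta>(-\<omega>)\<close>. The content of the theorem is that this formal substitution is
  asymptotically correct even though the sums of the individual powers diverge.

  The divergence is removed by Euler's transformation. With \<open>\<Delta> f x = f x - f (x + 1)\<close>,
  an alternating sum equals \<open>\<Sum>j<M. 2^(-j-1) (\<Delta>^j f)(1) + 2^(-M) \<Sum>n. (-1)^n (\<Delta>^M f)(n + 1)\<close>
  for every \<open>M\<close> (\<open>euler_sum_eq_suminf\<close>), and the right-hand side makes sense as soon as
  the \<open>M\<close>-th derivative of \<open>f\<close> is \<open>O(x^p)\<close> with \<open>p < -1\<close>. For \<open>f = t^(-s)\<close> it is holomorphic in \<open>Re s > 1 - M\<close>
  and so continues the eta function (\<open>euler_sum_powr\<close>). The existence of the continuation of zeta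
  itself is obtained from Taylor's formula for \<open>t^(1-s)\<close> between consecutive integers
  (\<open>zeta_continuation_step\<close>).

  By linearity the error after \<open>K\<close> terms is the Euler sum of the remainder
  \<open>r(x) = f(x/a) - \<Sum>k<K. H_k (x/a)^(\<omega>_k)\<close>, and only \<open>\<Delta>^M r\<close> has to be estimated. For
  \<open>x \<le> a/4\<close> the remainder is the tail of the series, and differencing it term by term gives
  \<open>O(a^(-\<omega>_K) x^(\<omega>_K - M))\<close> (\<open>series_tail_fdiff\<close>). For larger \<open>x\<close> all derivatives of \<open>f\<close> are
  \<open>O(x^q)\<close> with \<open>q = \<gamma> - 2\<mu> - 1/2\<close>: differentiation produces no growth because
  \<open>2 J_\<nu>' = J_(\<nu>-1) - J_(\<nu>+1)\<close> and every Bessel function is \<open>O(x^(-1/2))\<close>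
  (\<open>bessel_J_decay\<close>, \<open>smooth_decay_bessel\<close>). The scaling by \<open>1/a\<close> gains \<open>a^(-M)\<close>, so with \<open>M\<close> large
  this part is negligible (\<open>series_far_fdiff\<close>). The hypothesis \<open>2\<mu> - \<gamma> > 1/2\<close> says exactly that
  \<open>q < -1\<close>, so that \<open>x^q\<close> can be summed over the integers.
\<close>

section \<open>Forward differences and the Euler transformation\<close>

definition fdiff :: "(real \<Rightarrow> 'a::real_normed_vector) \<Rightarrow> real \<Rightarrow> 'a" where
  "fdiff f x = f x - f (x + 1)"

text \<open>
  The transform of \<open>\<Sum>n. (-1)^n f(n + 1)\<close> after \<open>M\<close> averaging steps. It is
  defined for any \<open>f\<close> and assigns a value to many divergent alternating sums.
\<close>

definition euler_sum :: "nat \<Rightarrow> (real \<Rightarrow> 'a::real_normed_vector) \<Rightarrow> 'a" where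
  "euler_sum M f =
     (\<Sum>j<M. (1 / 2) ^ Suc j *\<^sub>R (fdiff ^^ j) f 1) +
     (1 / 2) ^ M *\<^sub>R (\<Sum>n. (-1) ^ n *\<^sub>R (fdiff ^^ M) f (real n + 1))"

lemma fdiff_pow_Suc: "(fdiff ^^ Suc M) f x = (fdiff ^^ M) f x - (fdiff ^^ M) f (x + 1)"
  by (simp add: fdiff_def)

lemma fdiff_pow_cong:
  assumes "\<And>t. t \<in> {x..x + real M} \<Longrightarrow> f t = g t"
  shows "(fdiff ^^ M) f x = (fdiff ^^ M) g x"
  using assms
proof (induction M arbitrary: x)
  case (Suc M)
  have "(fdiff ^^ M) f x = (fdiff ^^ M) g x" "(fdiff ^^ M) f (x + 1) = (fdiff ^^ M) g (x + 1)"
    by (rule Suc.IH, rule Suc.prems, simp)+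
  then show ?case by (simp only: fdiff_pow_Suc)
qed simp

lemma fdiff_pow_linear:
  assumes "bounded_linear h"
  shows "(fdiff ^^ M) (\<lambda>x. h (f x)) x = h ((fdiff ^^ M) f x)"
proof (induction M arbitrary: x)
  case (Suc M)
  then show ?case
    by (simp only: fdiff_pow_Suc linear_diff[OF bounded_linear.linear[OF assms]])
qed simp

lemma fdiff_pow_diff: "(fdiff ^^ M) (\<lambda>x. f x - g x) x = (fdiff ^^ M) f x - (fdiff ^^ M) g x"
proof (induction M arbitrary: x)
  case (Suc M)
  then show ?case by (simp only: fdiff_pow_Suc) simp
qed simp

lemma fdiff_pow_sum:
  "(fdiff ^^ M) (\<lambda>x. \<Sum>k\<in>A. f k x) x = (\<Sum>k\<in>A. (fdiff ^^ M) (f k) x)"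
proof (induction M arbitrary: x)
  case (Suc M)
  then show ?case by (simp only: fdiff_pow_Suc sum_subtractf)
qed simp

lemma fdiff_pow_sums:
  assumes "\<And>t. t \<in> {x..x + real M} \<Longrightarrow> (\<lambda>k. u k t) sums f t"
  shows "(\<lambda>k. (fdiff ^^ M) (u k) x) sums (fdiff ^^ M) f x"
  using assms
proof (induction M arbitrary: x)
  case (Suc M)
  have "(\<lambda>k. (fdiff ^^ M) (u k) x) sums (fdiff ^^ M) f x"
       "(\<lambda>k. (fdiff ^^ M) (u k) (x + 1)) sums (fdiff ^^ M) f (x + 1)"
    by (rule Suc.IH, rule Suc.prems, simp)+
  then show ?case by (simp only: fdiff_pow_Suc sums_diff)
qed simp

lemma fdiff_pow_has_vector_derivative:
  assumes "\<And>t. t \<in> {x..x + real M} \<Longrightarrow> (f has_vector_derivative f' t) (at t)"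
  shows "((fdiff ^^ M) f has_vector_derivative (fdiff ^^ M) f' x) (at x)"
  using assms
proof (induction M arbitrary: x)
  case (Suc M)
  have 1: "((fdiff ^^ M) f has_vector_derivative (fdiff ^^ M) f' x) (at x)"
       and 2: "((fdiff ^^ M) f has_vector_derivative (fdiff ^^ M) f' (x + 1)) (at (x + 1))"
    by (rule Suc.IH, rule Suc.prems, simp)+
  have "((\<lambda>t. t + 1) has_vector_derivative 1) (at x)"
    by (auto intro!: derivative_eq_intros)
  from vector_diff_chain_at[OF this] 2
  have "((\<lambda>t. (fdiff ^^ M) f (t + 1)) has_vector_derivative (fdiff ^^ M) f' (x + 1)) (at x)"
    by (simp add: o_def)
  from has_vector_derivative_diff[OF 1 this]
  show ?case by (simp only: fdiff_pow_Suc[abs_def])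
qed simp

text \<open>
  An \<open>M\<close>-th difference is an average of the \<open>M\<close>-th derivative over \<open>[x, x + M]\<close> up to sign. Here
  each difference is estimated by the mean value inequality for the derivative of the next lower
  difference; \<open>g j\<close> plays the role of the \<open>j\<close>-th derivative.
\<close>

lemma norm_fdiff_pow_le:
  fixes g :: "nat \<Rightarrow> real \<Rightarrow> 'a::real_normed_vector"
  assumes "\<And>j t. j < M \<Longrightarrow> t \<in> {x..x + real M} \<Longrightarrow> (g j has_vector_derivative g (Suc j) t) (at t)"
    and "\<And>t. t \<in> {x..x + real M} \<Longrightarrow> norm (g M t) \<le> B"
  shows "norm ((fdiff ^^ M) (g 0) x) \<le> B"
  using assms
proof (induction M arbitrary: x g)
  case (Suc M)
  have der: "((fdiff ^^ M) (g 0) has_vector_derivative (fdiff ^^ M) (g 1) t) (at t)"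
    if "t \<in> {x..x + 1}" for t
    using that by (intro fdiff_pow_has_vector_derivative) (use Suc.prems(1)[of 0] in auto)
  have bd: "norm ((fdiff ^^ M) (g 1) t) \<le> B" if "t \<in> {x..x + 1}" for t
    using Suc.IH[of t "\<lambda>j. g (Suc j)"] Suc.prems that by auto
  have "norm ((fdiff ^^ M) (g 0) x - (fdiff ^^ M) (g 0) (x + 1)) \<le> B * norm (x - (x + 1))"
  proof (rule differentiable_bound[where S = "{x..x+1}"])
    show "((fdiff ^^ M) (g 0) has_derivative (\<lambda>h. h *\<^sub>R (fdiff ^^ M) (g 1) t)) (at t within {x..x+1})"
      if "t \<in> {x..x+1}" for t
      using der[OF that] has_derivative_at_withinI unfolding has_vector_derivative_def by blast
    show "onorm (\<lambda>h. h *\<^sub>R (fdiff ^^ M) (g 1) t) \<le> B" if "t \<in> {x..x+1}" for t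
      using bd[OF that] by (subst onorm_scaleR_left) (auto simp: onorm_id bounded_linear_ident)
  qed auto
  then show ?case by (simp only: fdiff_pow_Suc) simp
qed simp

text \<open>
  One averaging step: if \<open>S\<close> is the sum, then \<open>S = f(1)/2 + (S + (S - f(1)))/2\<close>, and
  \<open>S - f(1)\<close> is the same series without its first term; adding the two series term by term
  produces differences.
\<close>

lemma alternating_fdiff:
  assumes "summable (\<lambda>n. (-1) ^ n *\<^sub>R f (real n + 1))"
  shows "summable (\<lambda>n. (-1) ^ n *\<^sub>R fdiff f (real n + 1))" (is ?A)
    and "(\<Sum>n. (-1) ^ n *\<^sub>R f (real n + 1)) =
           (1 / 2) *\<^sub>R f 1 + (1 / 2) *\<^sub>R (\<Sum>n. (-1) ^ n *\<^sub>R fdiff f (real n + 1))" (is ?B)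
proof -
  let ?u = "\<lambda>n. (-1) ^ n *\<^sub>R f (real n + 1)" and ?S = "\<Sum>n. (-1) ^ n *\<^sub>R f (real n + 1)"
  have "?u sums ?S" using assms by (rule summable_sums)
  moreover from this have "(\<lambda>n. ?u (Suc n)) sums (?S - f 1)"
    by (subst sums_Suc_iff) simp
  ultimately have "(\<lambda>n. ?u n + ?u (Suc n)) sums (?S + (?S - f 1))"
    by (rule sums_add)
  also have "(\<lambda>n. ?u n + ?u (Suc n)) = (\<lambda>n. (-1) ^ n *\<^sub>R fdiff f (real n + 1))"
    by (rule ext) (simp add: fdiff_def scaleR_diff_right add.commute)
  finally have *: "(\<lambda>n. (-1) ^ n *\<^sub>R fdiff f (real n + 1)) sums (?S + (?S - f 1))" .
  then show ?A by (rule sums_summable)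
  have "(1/2) *\<^sub>R f 1 + (1/2) *\<^sub>R (?S + (?S - f 1)) = (1/2) *\<^sub>R (?S + ?S)"
    by (subst scaleR_add_right[symmetric]) simp
  also have "\<dots> = ?S" by (simp add: scaleR_2[symmetric])
  finally show ?B using * by (simp add: sums_iff)
qed

lemma euler_sum_eq_suminf:
  assumes "summable (\<lambda>n. (-1) ^ n *\<^sub>R f (real n + 1))"
  shows "summable (\<lambda>n. (-1) ^ n *\<^sub>R (fdiff ^^ M) f (real n + 1))" (is "?A M")
    and "euler_sum M f = (\<Sum>n. (-1) ^ n *\<^sub>R f (real n + 1))" (is "?B M")
proof -
  have "?A M \<and> ?B M"
  proof (induction M)
    case (Suc M)
    from alternating_fdiff[OF conjunct1[OF Suc]] conjunct2[OF Suc]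
    show ?case
      by (simp add: euler_sum_def scaleR_add_right add.assoc)
  qed (use assms in \<open>simp add: euler_sum_def\<close>)
  then show "?A M" "?B M" by blast+
qed

lemma summable_real_powr_plus1: "s < -1 \<Longrightarrow> summable (\<lambda>n. (real n + 1) powr s)"
  using summable_real_powr_iff[of s] summable_Suc_iff[of "\<lambda>n. real n powr s"] by (simp add: add.commute)

definition falling :: "'a \<Rightarrow> nat \<Rightarrow> 'a::{comm_ring_1}" where
  "falling s j = (\<Prod>i<j. s - of_nat i)"

lemma falling_0 [simp]: "falling s 0 = 1" and falling_Suc [simp]: "falling s (Suc j) = falling s j * (s - of_nat j)"
  by (simp_all add: falling_def)

lemma powr_has_vector_derivative:
  assumes "t > 0"
  shows "((\<lambda>t. complex_of_real t powr s) has_vector_derivative s * of_real t powr (s - 1)) (at t)"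
proof -
  have "((\<lambda>z. z powr s) has_field_derivative s * of_real t powr (s - 1)) (at (of_real t))"
    using assms by (intro has_field_derivative_powr) auto
  moreover have "(complex_of_real has_vector_derivative 1) (at t)"
    using has_vector_derivative_of_real[of "\<lambda>x. x" 1 "at t"] by simp
  ultimately show ?thesis
    using field_vector_diff_chain_at[of complex_of_real 1 t "\<lambda>z. z powr s"] by (simp add: o_def)
qed

text \<open>
  The bound \<open>B\<close> stays abstract because it is needed both for exponents with negative real part,
  where \<open>t^(s-M)\<close> is largest at \<open>x\<close>, and for large positive ones, where it is largest at \<open>x + M\<close>.
\<close>

lemma norm_fdiff_powr_le:
  assumes "x > 0" and "\<And>t. t \<in> {x..x + real M} \<Longrightarrow> t powr (Re s - real M) \<le> B"
  shows "norm ((fdiff ^^ M) (\<lambda>t. complex_of_real t powr s) x) \<le> norm (falling s M) * B"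
proof -
  define g where "g j t = falling s j * complex_of_real t powr (s - of_nat j)" for j t
  have "norm ((fdiff ^^ M) (g 0) x) \<le> norm (falling s M) * B"
  proof (rule norm_fdiff_pow_le)
    fix j t assume t: "t \<in> {x..x + real M}"
    then have t0: "t > 0" using assms by auto
    show "(g j has_vector_derivative g (Suc j) t) (at t)"
      using has_vector_derivative_mult_right[OF powr_has_vector_derivative[OF t0], of "falling s j" "s - of_nat j"]
      unfolding g_def by (simp add: algebra_simps)
    have "norm (complex_of_real t powr (s - of_nat M)) = t powr (Re s - real M)"
      using t0 by (simp add: norm_powr_real_powr)
    then show "norm (g M t) \<le> norm (falling s M) * B"
      unfolding g_def using assms(2)[OF t] by (simp add: norm_mult mult_left_mono)
  qed
  then show ?thesis by (simp add: g_def [abs_def])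
qed

lemma abs_fdiff_powr_le:
  fixes s :: real
  assumes "x > 0" and "\<And>t. t \<in> {x..x + real M} \<Longrightarrow> t powr (s - real M) \<le> B"
  shows "\<bar>(fdiff ^^ M) (\<lambda>t. t powr s) x\<bar> \<le> \<bar>falling s M\<bar> * B"
proof -
  have "(fdiff ^^ M) (\<lambda>t. complex_of_real t powr of_real s) x = (fdiff ^^ M) (\<lambda>t. of_real (t powr s)) x"
    using assms by (intro fdiff_pow_cong) (simp add: powr_of_real)
  also have "\<dots> = of_real ((fdiff ^^ M) (\<lambda>t. t powr s) x)"
    by (rule fdiff_pow_linear[OF bounded_linear_of_real])
  finally have 1: "norm ((fdiff ^^ M) (\<lambda>t. complex_of_real t powr of_real s) x) = \<bar>(fdiff ^^ M) (\<lambda>t. t powr s) x\<bar>"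
    by simp
  have 2: "falling (complex_of_real s) M = of_real (falling s M)"
    by (simp add: falling_def)
  show ?thesis
    using norm_fdiff_powr_le[of x M "of_real s" B] assms unfolding 1 2 by simp
qed

section \<open>Analytic continuation of the zeta function\<close>

lemma norm_nat_powr: "norm (of_nat (Suc n) powr s :: complex) = (real n + 1) powr Re s"
  using norm_powr_real_powr[of "of_nat (Suc n)" s] by (simp add: add.commute)

text \<open>
  The Weierstrass criterion in the form used for Dirichlet-like series. The continuous factor \<open>h\<close>
  is harmless because it is bounded on small discs, and there \<open>Re s\<close> exceeds \<open>c\<close> by a fixed amount.
\<close>

lemma powr_holomorphic_series:
  fixes u :: "nat \<Rightarrow> complex \<Rightarrow> complex" and h :: "complex \<Rightarrow> complex" and c e :: real
  assumes hol: "\<And>n. u n holomorphic_on {s. Re s > c}"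
    and bd: "\<And>n s. Re s > c \<Longrightarrow> norm (u n s) \<le> norm (h s) * (real n + 1) powr (e - Re s)"
    and h: "continuous_on UNIV h" and e: "e - c \<le> -1"
  shows "(\<lambda>s. \<Sum>n. u n s) holomorphic_on {s. Re s > c}"
    and "\<And>s. Re s > c \<Longrightarrow> summable (\<lambda>n. u n s)"
proof -
  let ?S = "{s. Re s > c}"
  have op: "open ?S" by (rule open_halfspace_Re_gt)
  obtain g where g: "\<forall>s\<in>?S. (\<lambda>n. u n s) sums g s \<and> g field_differentiable (at s)"
  proof (rule series_differentiable_comparison_complex[OF op])
    fix n s assume "s \<in> ?S"
    with hol op show "u n field_differentiable (at s)"
      by (auto simp: holomorphic_on_open field_differentiable_def)
  next
    fix s assume "s \<in> ?S"
    define d where "d = (Re s - c) / 2"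
    have d: "d > 0" using \<open>s \<in> ?S\<close> by (simp add: d_def)
    have "bounded (h ` cball s d)"
      by (intro compact_imp_bounded compact_continuous_image continuous_on_subset[OF h]) auto
    then obtain C where C: "\<And>y. y \<in> cball s d \<Longrightarrow> norm (h y) \<le> C" unfolding bounded_iff by blast
    have C0: "C \<ge> 0" using order_trans[OF norm_ge_zero C[of s]] d by simp
    define H where "H n = complex_of_real (C * (real n + 1) powr (e - c - d))" for n
    have "summable H"
      unfolding H_def using d e
      by (intro summable_of_real summable_mult summable_real_powr_plus1) auto
    moreover have "range H \<subseteq> \<real>\<^sub>\<ge>\<^sub>0" using C0 by (auto simp: H_def)
    moreover have "norm (u n y) \<le> norm (H n)" if "y \<in> ball s d \<inter> ?S" for n y
    proof -
      have "\<bar>Re (s - y)\<bar> \<le> norm (s - y)" by (rule abs_Re_le_cmod)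
      also have "\<dots> < d" using that by (simp add: dist_norm)
      finally have "Re y > c + d" by (simp add: d_def abs_if field_simps split: if_splits)
      have "norm (u n y) \<le> norm (h y) * (real n + 1) powr (e - Re y)" using bd that by auto
      also have "\<dots> \<le> C * (real n + 1) powr (e - c - d)"
        using C[of y] that \<open>Re y > c + d\<close> C0 by (intro mult_mono powr_mono) auto
      also have "\<dots> = norm (H n)" using C0 unfolding H_def norm_of_real by (simp add: abs_mult)
      finally show ?thesis .
    qed
    ultimately show "\<exists>d H. 0 < d \<and> summable H \<and> range H \<subseteq> \<real>\<^sub>\<ge>\<^sub>0 \<and>
        (\<forall>\<^sub>F n in sequentially. \<forall>y\<in>ball s d \<inter> ?S. cmod (u n y) \<le> cmod (H n))"
      using d by (intro exI[of _ d] exI[of _ H]) (auto intro!: always_eventually)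
  qed
  from g have sm: "(\<lambda>n. u n s) sums g s" if "Re s > c" for s using that by auto
  then show "summable (\<lambda>n. u n s)" if "Re s > c" for s using that sums_summable by blast
  have "g holomorphic_on ?S"
    using g by (auto simp: holomorphic_on_def field_differentiable_at_within)
  then show "(\<lambda>s. \<Sum>n. u n s) holomorphic_on ?S"
    by (rule holomorphic_transform) (use sm in \<open>auto simp: sums_iff\<close>)
qed

lemma holomorphic_falling [holomorphic_intros]:
  "f holomorphic_on A \<Longrightarrow> (\<lambda>s. falling (f s) k) holomorphic_on A"
  unfolding falling_def by (intro holomorphic_intros)

text \<open>
  The error of the Taylor polynomial of order \<open>N + 1\<close> of \<open>t^(1-s)\<close> from \<open>n + 1\<close> to \<open>n + 2\<close>. Summing
  over \<open>n\<close>, the left-hand side telescopes and the Taylor coefficients become zeta values at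
  \<open>s, s + 1, ..., s + N\<close>.
\<close>

definition power_step :: "nat \<Rightarrow> nat \<Rightarrow> complex \<Rightarrow> complex" where
  "power_step N n s = of_nat (n + 2) powr (1 - s) -
     (\<Sum>k\<le>Suc N. falling (1 - s) k / fact k * of_nat (n + 1) powr (1 - s - of_nat k))"

lemma holomorphic_powr_nat: "(f holomorphic_on A) \<Longrightarrow> (\<lambda>s. of_nat (Suc n) powr f s :: complex) holomorphic_on A"
  by (intro holomorphic_intros) auto

lemma norm_power_step_le:
  assumes "Re s > - real N"
  shows "norm (power_step N n s) \<le> norm (falling (1 - s) (N + 2)) * (real n + 1) powr (- 1 - real N - Re s)"
proof -
  let ?S = "closed_segment (complex_of_real (real n + 1)) (of_real (real n + 2))"
  define f where "f i z = falling (1 - s) i * z powr (1 - s - of_nat i)" for i z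
  let ?B = "norm (falling (1 - s) (N + 2)) * (real n + 1) powr (- 1 - real N - Re s)"
  have S: "\<exists>t. z = of_real t \<and> t \<ge> real n + 1" if "z \<in> ?S" for z
  proof -
    from that have "z \<in> of_real ` closed_segment (real n + 1) (real n + 2)"
      by (simp only: closed_segment_of_real)
    then show ?thesis by (auto simp: closed_segment_eq_real_ivl)
  qed
  have "norm (f 0 (of_real (real n + 2)) - (\<Sum>i\<le>Suc N. f i (of_real (real n + 1)) *
          (of_real (real n + 2) - of_real (real n + 1)) ^ i / fact i)) \<le>
        ?B * norm (complex_of_real (real n + 2) - of_real (real n + 1)) ^ Suc (Suc N) / fact (Suc N)"
  proof (rule complex_Taylor[where S = ?S])
    fix i z assume "z \<in> ?S" "i \<le> Suc N"
    then obtain t where t: "z = of_real t" "t \<ge> real n + 1" using S by blast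
    then have nz: "z \<notin> \<real>\<^sub>\<le>\<^sub>0" by auto
    show "(f i has_field_derivative f (Suc i) z) (at z within ?S)"
    proof -
      have "((\<lambda>z. z powr (1 - s - of_nat i)) has_field_derivative
              (1 - s - of_nat i) * z powr (1 - s - of_nat i - 1)) (at z within ?S)"
        by (rule has_field_derivative_at_within[OF has_field_derivative_powr[OF nz]])
      from DERIV_cmult[OF this, of "falling (1 - s) i"] show ?thesis
        by (simp add: f_def[abs_def] diff_diff_eq mult.assoc add.commute)
    qed
  next
    fix z assume "z \<in> ?S"
    then obtain t where t: "z = of_real t" "t \<ge> real n + 1" using S by blast
    have "norm (z powr (1 - s - of_nat (Suc (Suc N)))) = t powr (- 1 - real N - Re s)"
      using t by (simp add: norm_powr_real_powr algebra_simps)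
    also have "\<dots> \<le> (real n + 1) powr (- 1 - real N - Re s)"
      using t assms by (intro powr_mono2') auto
    finally show "norm (f (Suc (Suc N)) z) \<le> ?B"
      unfolding f_def norm_mult by (intro mult_mono) auto
  qed auto
  also have "\<dots> = ?B / fact (Suc N)" by simp
  also have "\<dots> \<le> ?B / 1" by (intro divide_left_mono) (auto simp: fact_ge_1 simp del: fact_Suc)
  finally show ?thesis by (simp add: f_def power_step_def add_ac)
qed

lemma dirichlet_summable:
  assumes "Re s > 1"
  shows "summable (\<lambda>n. of_nat (Suc n) powr (- s) :: complex)"
proof (rule summable_norm_cancel)
  have "summable (\<lambda>n. (real n + 1) powr (- Re s))" using assms by (intro summable_real_powr_plus1) auto
  then show "summable (\<lambda>n. norm (of_nat (Suc n) powr (- s) :: complex))"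
    by (simp add: norm_nat_powr del: of_nat_Suc)
qed

definition dirichlet :: "complex \<Rightarrow> complex" where
  "dirichlet s = (\<Sum>n. of_nat (Suc n) powr (- s))"

lemma dirichlet_sums: "Re s > 1 \<Longrightarrow> (\<lambda>n. of_nat (Suc n) powr (- s)) sums dirichlet s"
  unfolding dirichlet_def by (intro summable_sums dirichlet_summable)

lemma dirichlet_holomorphic: "dirichlet holomorphic_on {s. Re s > 1}"
  unfolding dirichlet_def[abs_def]
proof (rule powr_holomorphic_series(1)[where h = "\<lambda>_. 1" and e = 0])
  show "(\<lambda>s. of_nat (Suc n) powr - s) holomorphic_on {s. 1 < Re s}" for n
    by (intro holomorphic_powr_nat holomorphic_intros)
qed (auto simp: norm_nat_powr simp del: of_nat_Suc)

text \<open>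
  The identity \<open>\<Sum>n. power_step N n s = -1 - \<Sum>k=1..N+1. (1-s)(-s)...(2-s-k)/k! \<zeta>(s+k-1)\<close>
  expresses \<open>(s - 1) \<zeta>(s)\<close> by values of \<open>\<zeta>\<close> further to the right and by a series that converges one
  unit further to the left. It is stated for \<open>Z(s) = (s - 1) \<zeta>(s)\<close>: the last factor of each
  coefficient cancels the pole of \<open>\<zeta>(s + k - 1)\<close>, so no singularities have to be removed.
\<close>

lemma zeta_continuation_step:
  assumes "\<exists>Z. Z holomorphic_on {s. Re s > 1 - real N} \<and> (\<forall>s. Re s > 1 \<longrightarrow> Z s = (s - 1) * dirichlet s)"
  shows "\<exists>Z. Z holomorphic_on {s. Re s > 1 - real (Suc N)} \<and> (\<forall>s. Re s > 1 \<longrightarrow> Z s = (s - 1) * dirichlet s)"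
proof -
  obtain Z where Z: "Z holomorphic_on {s. Re s > 1 - real N}"
    and Zeq: "\<And>s. Re s > 1 \<Longrightarrow> Z s = (s - 1) * dirichlet s"
    using assms by blast
  let ?S = "{s. Re s > - real N}"
  define R where "R s = (\<Sum>n. power_step N n s)" for s
  define Y where "Y s = 1 + R s - (\<Sum>k=1..N. falling (1 - s) k / fact (Suc k) * Z (s + of_nat k))" for s
  have hp: "power_step N n holomorphic_on ?S" for n
    unfolding power_step_def[abs_def]
    using holomorphic_powr_nat[of "\<lambda>s. 1 - s" ?S "Suc n"] holomorphic_powr_nat[of "\<lambda>s. 1 - s - of_nat k" ?S n for k]
    by (intro holomorphic_intros) (auto intro!: holomorphic_intros)
  have bd: "norm (power_step N n s) \<le> norm (falling (1 - s) (N + 2)) * (real n + 1) powr ((- 1 - real N) - Re s)"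
    if "Re s > - real N" for n s
    using norm_power_step_le[OF that, of n] by simp
  have cont: "continuous_on UNIV (\<lambda>s::complex. falling (1 - s) (N + 2))"
    by (intro holomorphic_on_imp_continuous_on holomorphic_intros)
  note ser = powr_holomorphic_series[OF hp bd cont, simplified]
  have "R holomorphic_on ?S" unfolding R_def[abs_def] using ser(1) by simp
  moreover have "(\<lambda>s. Z (s + of_nat k)) holomorphic_on ?S" if "k \<in> {1..N}" for k
    using that by (intro holomorphic_on_compose_gen[OF _ Z, unfolded o_def]) (auto intro!: holomorphic_intros)
  ultimately have "Y holomorphic_on ?S"
    unfolding Y_def[abs_def] by (intro holomorphic_intros) auto
  moreover have "Y s = (s - 1) * dirichlet s" if s: "Re s > 1" for s
  proof -
    define p where "p n = complex_of_nat (Suc n) powr (1 - s)" for n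
    have "p \<longlonglongrightarrow> 0"
    proof (rule tendsto_norm_zero_cancel)
      have "(\<lambda>n. real (Suc n) powr (1 - Re s)) \<longlonglongrightarrow> 0"
        using s by (intro tendsto_neg_powr filterlim_compose[OF filterlim_real_sequentially] filterlim_Suc) auto
      then show "(\<lambda>n. norm (p n)) \<longlonglongrightarrow> 0" unfolding p_def norm_nat_powr by (simp add: add.commute)
    qed
    then have "(\<lambda>n. p (Suc n) - p n) sums (0 - p 0)" by (rule telescope_sums)
    then have tel: "(\<lambda>n. p (Suc n) - p n) sums (- 1)" by (simp add: p_def)
    have "(\<lambda>n. \<Sum>k=1..Suc N. falling (1 - s) k / fact k * of_nat (Suc n) powr (- (s + of_nat (k - 1)))) sums
          (\<Sum>k=1..Suc N. falling (1 - s) k / fact k * dirichlet (s + of_nat (k - 1)))"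
      using s by (intro sums_sum sums_mult dirichlet_sums) auto
    from sums_diff[OF tel this]
    have "(\<lambda>n. power_step N n s) sums
          (- 1 - (\<Sum>k=1..Suc N. falling (1 - s) k / fact k * dirichlet (s + of_nat (k - 1))))"
    proof (rule sums_cong[THEN iffD1, rotated])
      fix n
      have "{..Suc N} = insert 0 {1..Suc N}" by auto
      moreover have "(\<Sum>k=1..Suc N. falling (1 - s) k / fact k * of_nat (Suc n) powr (- (s + of_nat (k - 1)))) =
            (\<Sum>k=1..Suc N. falling (1 - s) k / fact k * of_nat (n + 1) powr (1 - s - of_nat k))"
        by (intro sum.cong refl) (auto simp: of_nat_diff algebra_simps)
      ultimately show "p (Suc n) - p n - (\<Sum>k=1..Suc N. falling (1 - s) k / fact k * of_nat (Suc n) powr (- (s + of_nat (k - 1)))) =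
            power_step N n s"
        by (simp add: power_step_def p_def add_ac del: sum.cl_ivl_Suc)
    qed
    then have "R s = - 1 - (\<Sum>k=1..Suc N. falling (1 - s) k / fact k * dirichlet (s + of_nat (k - 1)))"
      by (simp add: R_def sums_iff)
    also have "(\<Sum>k=1..Suc N. falling (1 - s) k / fact k * dirichlet (s + of_nat (k - 1))) =
               (\<Sum>k=0..N. falling (1 - s) (Suc k) / fact (Suc k) * dirichlet (s + of_nat k))"
      by (rule sum.reindex_bij_witness[of _ Suc "\<lambda>k. k - 1"]) auto
    also have "{0..N} = insert 0 {1..N}" by auto
    also have "(\<Sum>k\<in>insert 0 {1..N}. falling (1 - s) (Suc k) / fact (Suc k) * dirichlet (s + of_nat k)) =
       (1 - s) * dirichlet s + (\<Sum>k=1..N. falling (1 - s) (Suc k) / fact (Suc k) * dirichlet (s + of_nat k))"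
      by simp
    also have "(\<Sum>k=1..N. falling (1 - s) (Suc k) / fact (Suc k) * dirichlet (s + of_nat k)) =
               (\<Sum>k=1..N. - (falling (1 - s) k / fact (Suc k) * Z (s + of_nat k)))"
    proof (intro sum.cong refl)
      fix k
      have "Z (s + of_nat k) = (s + of_nat k - 1) * dirichlet (s + of_nat k)"
        using s by (intro Zeq) auto
      also have "\<dots> = - ((1 - s - of_nat k) * dirichlet (s + of_nat k))" by (simp add: algebra_simps)
      finally have "Z (s + of_nat k) = - ((1 - s - of_nat k) * dirichlet (s + of_nat k))" .
      then show "falling (1 - s) (Suc k) / fact (Suc k) * dirichlet (s + of_nat k) =
                 - (falling (1 - s) k / fact (Suc k) * Z (s + of_nat k))"
        by (simp add: mult_ac del: fact_Suc)
    qed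
    finally show ?thesis by (simp add: Y_def sum_negf algebra_simps del: fact_Suc)
  qed
  ultimately show ?thesis by (intro exI[of _ Y]) simp
qed

text \<open>
  The continuations to the half-planes \<open>Re s > 1 - N\<close> agree by the identity theorem; the glued
  function uses at \<open>s\<close> the first half-plane that contains it with some room.
\<close>

lemma zeta_continuation:
  "\<exists>Z. Z holomorphic_on UNIV \<and> (\<forall>s. Re s > 1 \<longrightarrow> Z s = (s - 1) * dirichlet s)"
proof -
  have "\<exists>Z. Z holomorphic_on {s. Re s > 1 - real N} \<and> (\<forall>s. Re s > 1 \<longrightarrow> Z s = (s - 1) * dirichlet s)" for N
  proof (induction N)
    case 0
    show ?case
      by (rule exI[of _ "\<lambda>s. (s - 1) * dirichlet s"]) (auto intro!: holomorphic_intros dirichlet_holomorphic)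
  qed (rule zeta_continuation_step)
  then have "\<forall>N. \<exists>Z. Z holomorphic_on {s. Re s > 1 - real N} \<and> (\<forall>s. Re s > 1 \<longrightarrow> Z s = (s - 1) * dirichlet s)"
    by blast
  from choice[OF this] obtain Z where hol: "\<And>N. Z N holomorphic_on {s. Re s > 1 - real N}"
    and eq: "\<And>N s. Re s > 1 \<Longrightarrow> Z N s = (s - 1) * dirichlet s"
    by blast
  have agree: "Z N s = Z M s" if "Re s > 1 - real N" "N \<le> M" for N M s
  proof (rule analytic_continuation_open[where s = "{s. Re s > 1}" and s' = "{s. Re s > 1 - real N}" and f = "Z N" and g = "Z M"])
    show "Z M holomorphic_on {s. 1 - real N < Re s}"
      by (rule holomorphic_on_subset[OF hol]) (use that in auto)
    show "{s. 1 < Re s} \<noteq> {}" using exI[of "\<lambda>s. Re s > 1" 2] by simp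
    show "connected {s. 1 - real N < Re s}"
      by (intro convex_connected convex_halfspace_Re_gt)
    show "Z N z = Z M z" if "z \<in> {s. 1 < Re s}" for z using that eq[of z] by simp
    show "{s. 1 < Re s} \<subseteq> {s. 1 - real N < Re s}" by auto
    show "s \<in> {s. 1 - real N < Re s}" using that by simp
  qed (intro hol open_halfspace_Re_gt)+
  define idx where "idx s = nat \<lceil>2 - Re s\<rceil>" for s
  define Y where "Y s = Z (idx s) s" for s
  have idx: "Re s > 1 - real (idx s)" for s unfolding idx_def by linarith
  have Y: "Y s = Z N s" if "Re s > 1 - real N" for s N
  proof (cases "N \<le> idx s")
    case True
    from agree[OF that this] show ?thesis by (simp add: Y_def)
  next
    case False
    with agree[OF idx, of s N] show ?thesis by (simp add: Y_def)
  qed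
  have "Y field_differentiable (at s)" for s
  proof -
    obtain D where "(Z (idx s) has_field_derivative D) (at s)"
      using hol[of "idx s"] idx[of s] by (auto simp: holomorphic_on_open open_halfspace_Re_gt)
    then have "(Y has_field_derivative D) (at s)"
      by (rule has_field_derivative_transform_within_open[where S = "{z. Re z > 1 - real (idx s)}"])
        (simp_all add: open_halfspace_Re_gt idx Y)
    then show ?thesis by (auto simp: field_differentiable_def)
  qed
  then have "Y holomorphic_on UNIV" by (simp add: holomorphic_on_def)
  moreover have "Y s = (s - 1) * dirichlet s" if "Re s > 1" for s
    using eq[OF that, of 0] Y[of 0 s] that by simp
  ultimately show ?thesis by blast
qed

lemma zeta_holomorphic: "zeta holomorphic_on (- {1})"
  and zeta_sums: "Re s > 1 \<Longrightarrow> (\<lambda>n. of_nat (Suc n) powr (- s)) sums zeta s"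
proof -
  obtain Z where Z: "Z holomorphic_on UNIV" "\<And>s. Re s > 1 \<Longrightarrow> Z s = (s - 1) * dirichlet s"
    using zeta_continuation by blast
  have "\<exists>f. f holomorphic_on (- {1}) \<and> (\<forall>s. Re s > 1 \<longrightarrow> (\<lambda>n. of_nat (Suc n) powr (- s)) sums f s)"
  proof (intro exI conjI allI impI)
    show "(\<lambda>s. Z s / (s - 1)) holomorphic_on (- {1})"
      by (intro holomorphic_intros holomorphic_on_subset[OF Z(1)]) auto
    show "(\<lambda>n. of_nat (Suc n) powr (- s)) sums (Z s / (s - 1))" if "Re s > 1" for s
      using dirichlet_sums[OF that] Z(2)[OF that] that by auto
  qed
  from someI_ex[OF this] show "zeta holomorphic_on (- {1})"
    and "Re s > 1 \<Longrightarrow> (\<lambda>n. of_nat (Suc n) powr (- s)) sums zeta s"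
    unfolding zeta_def by blast+
qed


section \<open>Euler sums of powers\<close>

lemma norm_fdiff_powr_nat_le:
  assumes "Re s + real M > 0"
  shows "norm ((fdiff ^^ M) (\<lambda>t. complex_of_real t powr (- s)) (real n + 1)) \<le>
           norm (falling (- s) M) * (real n + 1) powr (- Re s - real M)"
proof (rule norm_fdiff_powr_le)
  fix t assume "t \<in> {real n + 1..real n + 1 + real M}"
  then show "t powr (Re (- s) - real M) \<le> (real n + 1) powr (- Re s - real M)"
    using assms by (auto intro!: powr_mono2')
qed simp

lemma holomorphic_fdiff_powr:
  assumes "x > 0"
  shows "(\<lambda>s. (fdiff ^^ j) (\<lambda>t. complex_of_real t powr (- s)) x) holomorphic_on A"
  using assms
proof (induction j arbitrary: x)
  case 0
  then show ?case by (auto intro!: holomorphic_intros)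
next
  case (Suc j)
  then show ?case
    by (simp only: fdiff_pow_Suc) (intro holomorphic_intros Suc.IH, auto)
qed

lemma holomorphic_scaleR: "f holomorphic_on A \<Longrightarrow> (\<lambda>s. c *\<^sub>R f s :: complex) holomorphic_on A"
  by (simp add: scaleR_conv_of_real holomorphic_intros)

lemma euler_sum_powr_holomorphic:
  "(\<lambda>s. euler_sum M (\<lambda>t. complex_of_real t powr (- s))) holomorphic_on {s. Re s > 1 - real M}"
  unfolding euler_sum_def
proof (intro holomorphic_on_add holomorphic_on_sum holomorphic_scaleR holomorphic_fdiff_powr)
  let ?u = "\<lambda>n s. (-1) ^ n *\<^sub>R (fdiff ^^ M) (\<lambda>t. complex_of_real t powr (- s)) (real n + 1)"
  show "(\<lambda>s. \<Sum>n. ?u n s) holomorphic_on {s. Re s > 1 - real M}"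
  proof (rule powr_holomorphic_series(1)[where h = "\<lambda>s. falling (- s) M" and e = "- real M"])
    show "?u n holomorphic_on {s. Re s > 1 - real M}" for n
      by (intro holomorphic_scaleR holomorphic_fdiff_powr) auto
    show "norm (?u n s) \<le> norm (falling (- s) M) * (real n + 1) powr (- real M - Re s)"
      if "1 - real M < Re s" for n s
    proof -
      have "norm (?u n s) \<le> norm (falling (- s) M) * (real n + 1) powr (- Re s - real M)"
        using norm_fdiff_powr_nat_le[of s M n] that by simp
      also have "- Re s - real M = - real M - Re s" by simp
      finally show ?thesis .
    qed
    show "continuous_on UNIV (\<lambda>s::complex. falling (- s) M)"
      by (intro holomorphic_on_imp_continuous_on holomorphic_intros)
  qed auto
qed auto

text \<open>
  The odd-indexed terms of the Dirichlet series, counted from 0, are \<open>2^(-s)\<close> times the whole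
  series, and the alternating series differs from the full one by twice their sum.
\<close>

lemma alternating_dirichlet:
  assumes "Re s > 1"
  shows "(\<lambda>n. (-1) ^ n *\<^sub>R complex_of_real (real n + 1) powr (- s)) sums ((1 - 2 powr (1 - s)) * zeta s)"
proof -
  define p where "p n = complex_of_nat (Suc n) powr (- s)" for n
  have p: "p sums zeta s" unfolding p_def[abs_def] by (rule zeta_sums[OF assms])
  have "summable (\<lambda>n. norm (p n))"
    unfolding p_def norm_nat_powr using assms by (intro summable_real_powr_plus1) auto
  then have "summable (\<lambda>n. (-1) ^ n *\<^sub>R p n)"
    by (intro summable_norm_cancel[of "\<lambda>n. (-1) ^ n *\<^sub>R p n"]) simp
  then obtain A where A: "(\<lambda>n. (-1) ^ n *\<^sub>R p n) sums A" by (auto simp: summable_def)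
  \<comment> \<open>Grouping the terms in pairs, without and with signs, isolates those with odd index.\<close>
  have grp: "{m * 2..<m * 2 + 2} = {m * 2, Suc (m * 2)}" for m :: nat by auto
  have "(\<lambda>m. p (m * 2) + p (Suc (m * 2))) sums zeta s"
    using sums_group[OF p, of 2] by (simp add: grp)
  moreover have "(\<lambda>m. p (m * 2) - p (Suc (m * 2))) sums A"
    using sums_group[OF A, of 2] by (simp add: grp)
  ultimately have "(\<lambda>m. (p (m * 2) + p (Suc (m * 2))) - (p (m * 2) - p (Suc (m * 2)))) sums (zeta s - A)"
    by (rule sums_diff)
  moreover have "(p (m * 2) + p (Suc (m * 2))) - (p (m * 2) - p (Suc (m * 2))) = 2 powr (1 - s) * p m" for m
  proof -
    have "p (Suc (m * 2)) = (of_real 2 * of_real (real (Suc m))) powr (- s)"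
      by (simp add: p_def algebra_simps)
    also have "\<dots> = of_real 2 powr (- s) * of_real (real (Suc m)) powr (- s)"
      by (rule powr_times_real) auto
    finally have "p (Suc (m * 2)) = 2 powr (- s) * p m" by (simp add: p_def)
    moreover have "2 powr (1 - s) = 2 * (2::complex) powr (- s)" by (simp add: powr_diff powr_minus field_simps)
    ultimately show ?thesis by simp
  qed
  ultimately have "(\<lambda>m. 2 powr (1 - s) * p m) sums (zeta s - A)" by simp
  with sums_mult[OF p, of "2 powr (1 - s)"] have "zeta s - A = 2 powr (1 - s) * zeta s"
    by (metis sums_unique2)
  then have "A = (1 - 2 powr (1 - s)) * zeta s" by (simp add: algebra_simps)
  with A show ?thesis by (simp add: p_def add.commute)
qed

text \<open>
  Both sides are holomorphic in a punctured half-plane and agree for \<open>Re s > 1\<close>, where the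
  alternating series converges.
\<close>

lemma euler_sum_powr:
  assumes "Re s > 1 - real M" "s \<noteq> 1"
  shows "euler_sum M (\<lambda>t. complex_of_real t powr (- s)) = (1 - 2 powr (1 - s)) * zeta s"
proof (rule analytic_continuation_open[where s = "{s. Re s > 1}" and s' = "{s. Re s > 1 - real M} - {1}"
      and f = "\<lambda>s. euler_sum M (\<lambda>t. complex_of_real t powr (- s))" and g = "\<lambda>s. (1 - 2 powr (1 - s)) * zeta s"])
  show "open {s. 1 < Re s}" by (rule open_halfspace_Re_gt)
  show "open ({s. 1 - real M < Re s} - {1})"
    by (intro open_Diff open_halfspace_Re_gt) simp
  show "{s. 1 < Re s} \<noteq> {}" using exI[of "\<lambda>s. Re s > 1" 2] by simp
  show "connected ({s. 1 - real M < Re s} - {1})"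
    by (intro connected_open_delete open_halfspace_Re_gt convex_connected convex_halfspace_Re_gt) simp
  show "{s. 1 < Re s} \<subseteq> {s. 1 - real M < Re s} - {1}" by auto
  show "(\<lambda>s. euler_sum M (\<lambda>t. complex_of_real t powr - s)) holomorphic_on {s. 1 - real M < Re s} - {1}"
    by (rule holomorphic_on_subset[OF euler_sum_powr_holomorphic]) auto
  show "(\<lambda>s. (1 - 2 powr (1 - s)) * zeta s) holomorphic_on {s. 1 - real M < Re s} - {1}"
    by (intro holomorphic_intros holomorphic_on_subset[OF zeta_holomorphic]) auto
  show "euler_sum M (\<lambda>t. complex_of_real t powr (- s)) = (1 - 2 powr (1 - s)) * zeta s" if "s \<in> {s. 1 < Re s}" for s
    using alternating_dirichlet[of s] that by (simp add: sums_iff euler_sum_eq_suminf)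
  show "s \<in> {s. 1 - real M < Re s} - {1}" using assms by simp
qed

lemma euler_sum_real_powr:
  fixes w :: real
  assumes "w < real M - 1" "w \<noteq> -1"
  shows "euler_sum M (\<lambda>t. t powr w) = (1 - 2 powr (1 + w)) * Re (zeta (of_real (- w)))"
proof -
  have eq: "(fdiff ^^ j) (\<lambda>t. complex_of_real t powr (- of_real (- w))) x = of_real ((fdiff ^^ j) (\<lambda>t. t powr w) x)"
    if "x > 0" for j x
  proof -
    have "(fdiff ^^ j) (\<lambda>t. complex_of_real t powr (- of_real (- w))) x = (fdiff ^^ j) (\<lambda>t. of_real (t powr w)) x"
      using that by (intro fdiff_pow_cong) (simp add: powr_of_real)
    also have "\<dots> = of_real ((fdiff ^^ j) (\<lambda>t. t powr w) x)"
      by (rule fdiff_pow_linear[OF bounded_linear_of_real])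
    finally show ?thesis .
  qed
  have sm: "summable (\<lambda>n. (-1) ^ n *\<^sub>R (fdiff ^^ M) (\<lambda>t. complex_of_real t powr (- of_real (- w))) (real n + 1))"
  proof (rule summable_comparison_test')
    show "summable (\<lambda>n. norm (falling (- complex_of_real (- w)) M) * (real n + 1) powr (- Re (of_real (- w)) - real M))"
      using assms by (intro summable_mult summable_real_powr_plus1) auto
    show "norm ((-1) ^ n *\<^sub>R (fdiff ^^ M) (\<lambda>t. complex_of_real t powr (- of_real (- w))) (real n + 1)) \<le>
        norm (falling (- complex_of_real (- w)) M) * (real n + 1) powr (- Re (of_real (- w)) - real M)" for n
      using norm_fdiff_powr_nat_le[of "of_real (- w)" M n] assms by simp
  qed
  have "Re (euler_sum M (\<lambda>t. complex_of_real t powr (- of_real (- w)))) = euler_sum M (\<lambda>t. t powr w)"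
    unfolding euler_sum_def using Re_suminf[OF sm] by (simp add: eq[simplified])
  moreover have "Re (euler_sum M (\<lambda>t. complex_of_real t powr (- of_real (- w)))) =
      Re ((1 - 2 powr (1 - complex_of_real (- w))) * zeta (of_real (- w)))"
    using assms by (subst euler_sum_powr) (auto simp: complex_eq_iff)
  moreover have "1 - 2 powr (1 - complex_of_real (- w)) = of_real (1 - 2 powr (1 + w))"
    using powr_of_real[of 2 "1 + w"] by simp
  ultimately show ?thesis by simp
qed

section \<open>Bessel functions of real order\<close>

text \<open>
  The Bessel function is \<open>(x/2)^s\<close> times the entire function \<open>bessel_entire s\<close> of \<open>x^2/4\<close>.
  Separating the two factors reduces everything to one power series.
\<close>

definition bessel_coeff :: "real \<Rightarrow> nat \<Rightarrow> real" where
  "bessel_coeff s m = (-1) ^ m * rGamma (s + real m + 1) / fact m"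

definition bessel_entire :: "real \<Rightarrow> real \<Rightarrow> real" where
  "bessel_entire s z = (\<Sum>m. bessel_coeff s m * z ^ m)"

text \<open>
  From some index on the argument of 1/Gamma is at least 1, and there the functional equation shows
  that each unit step decreases the absolute value.
\<close>

lemma rGamma_bounded: "\<exists>B\<ge>0. \<forall>m::nat. \<bar>rGamma (s + real m + 1)\<bar> \<le> B"
proof -
  obtain N :: nat where N: "real N \<ge> \<bar>s\<bar> + 1" using real_arch_simple by blast
  have mono: "\<bar>rGamma (s + real (N + k) + 1)\<bar> \<le> \<bar>rGamma (s + real N + 1)\<bar>" for k
  proof (induction k)
    case (Suc k)
    have "rGamma (s + real (N + k) + 1) = (s + real (N + k) + 1) * rGamma (s + real (N + k) + 1 + 1)"
      by (rule rGamma_plus1[symmetric])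
    moreover have "1 \<le> s + real (N + k) + 1" using N by auto
    ultimately have "\<bar>rGamma (s + real (N + k) + 1)\<bar> \<ge> 1 * \<bar>rGamma (s + real (N + k) + 1 + 1)\<bar>"
      by (simp only: abs_mult) (intro mult_right_mono, auto)
    with Suc show ?case by (simp add: algebra_simps)
  qed simp
  define B where "B = (\<Sum>m\<le>N. \<bar>rGamma (s + real m + 1)\<bar>)"
  have le: "\<bar>rGamma (s + real m + 1)\<bar> \<le> B" if "m \<le> N" for m
    unfolding B_def using that by (intro member_le_sum[where f = "\<lambda>m. \<bar>rGamma (s + real m + 1)\<bar>"]) auto
  have "\<bar>rGamma (s + real m + 1)\<bar> \<le> B" for m
  proof (cases "m \<le> N")
    case False
    then have "m = N + (m - N)" by simp
    with mono[of "m - N"] le[of N] show ?thesis by simp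
  qed (use le in blast)
  moreover have "B \<ge> 0" unfolding B_def by (intro sum_nonneg) auto
  ultimately show ?thesis by blast
qed

lemma summable_abs_bessel: "summable (\<lambda>m. \<bar>bessel_coeff s m * z ^ m\<bar>)"
proof -
  obtain B where B: "B \<ge> 0" "\<And>m::nat. \<bar>rGamma (s + real m + 1)\<bar> \<le> B" using rGamma_bounded by blast
  show ?thesis
  proof (rule summable_comparison_test')
    show "summable (\<lambda>m. B * (\<bar>z\<bar> ^ m / fact m))"
      using summable_exp[of "\<bar>z\<bar>"] by (intro summable_mult) (simp add: field_simps)
    show "norm \<bar>bessel_coeff s m * z ^ m\<bar> \<le> B * (\<bar>z\<bar> ^ m / fact m)" for m
      using B(2)[of m] by (simp add: bessel_coeff_def abs_mult power_abs divide_right_mono mult_right_mono)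
  qed
qed

lemma summable_bessel: "summable (\<lambda>m. bessel_coeff s m * z ^ m)"
  by (rule summable_rabs_cancel[OF summable_abs_bessel])

lemma bessel_coeff_Suc: "real (Suc m) * bessel_coeff s (Suc m) = - bessel_coeff (s + 1) m"
proof -
  have eq: "s + real (Suc m) + 1 = s + 1 + real m + 1" by simp
  show ?thesis
    unfolding bessel_coeff_def fact_Suc eq by (simp add: field_simps del: of_nat_Suc)
qed

lemma bessel_entire_deriv: "(bessel_entire s has_real_derivative - bessel_entire (s + 1) z) (at z)"
proof -
  have "diffs (bessel_coeff s) m = - bessel_coeff (s + 1) m" for m
    unfolding diffs_def by (rule bessel_coeff_Suc)
  then have "(\<Sum>m. diffs (bessel_coeff s) m * z ^ m) = - bessel_entire (s + 1) z"
    using suminf_minus[OF summable_bessel] by (simp add: bessel_entire_def)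
  moreover have "(bessel_entire s has_real_derivative (\<Sum>m. diffs (bessel_coeff s) m * z ^ m)) (at z)"
    unfolding bessel_entire_def[abs_def] by (rule termdiffs_strong_converges_everywhere) (rule summable_bessel)
  ultimately show ?thesis by simp
qed

lemma bessel_entire_rec: "bessel_entire (s - 1) z = s * bessel_entire s z - z * bessel_entire (s + 1) z"
proof -
  have "(\<lambda>m. bessel_coeff s m * z ^ m) sums bessel_entire s z" for s
    unfolding bessel_entire_def by (rule summable_sums[OF summable_bessel])
  note sm = this
  have 1: "(\<lambda>m. s * (bessel_coeff s m * z ^ m)) sums (s * bessel_entire s z)"
    by (intro sums_mult sm)
  have "(\<lambda>m. real (Suc m) * bessel_coeff s (Suc m) * z ^ Suc m) sums (- (z * bessel_entire (s + 1) z))"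
  proof -
    have "real (Suc m) * bessel_coeff s (Suc m) * z ^ Suc m = - (z * (bessel_coeff (s + 1) m * z ^ m))" for m
      by (simp only: bessel_coeff_Suc) simp
    then show ?thesis using sums_minus[OF sums_mult[OF sm, of z "s + 1"]] by simp
  qed
  then have 2: "(\<lambda>m. real m * bessel_coeff s m * z ^ m) sums (- (z * bessel_entire (s + 1) z))"
    by (subst (asm) sums_Suc_iff) simp
  have "bessel_coeff (s - 1) m = (s + real m) * bessel_coeff s m" for m
    unfolding bessel_coeff_def by (simp add: rGamma_plus1[of "s + real m", symmetric])
  then have "(\<lambda>m. bessel_coeff (s - 1) m * z ^ m) = (\<lambda>m. s * (bessel_coeff s m * z ^ m) + real m * bessel_coeff s m * z ^ m)"
    by (simp add: algebra_simps)
  with sums_add[OF 1 2] sm[of "s - 1"] show ?thesis by (simp add: sums_iff)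
qed

lemma bessel_J_eq:
  assumes "x > 0"
  shows "bessel_J s x = (x / 2) powr s * bessel_entire s (x\<^sup>2 / 4)"
proof -
  have "(-1) ^ m * rGamma (s + real m + 1) / fact m * (x / 2) powr (s + 2 * real m) =
        (x / 2) powr s * (bessel_coeff s m * (x\<^sup>2 / 4) ^ m)" for m
  proof -
    have "(x / 2) powr (2 * real m) = (x / 2) ^ (2 * m)"
      using assms by (subst powr_realpow[symmetric]) auto
    also have "\<dots> = (x\<^sup>2 / 4) ^ m" by (simp add: power_mult power_divide)
    finally show ?thesis by (simp add: powr_add bessel_coeff_def)
  qed
  then show ?thesis
    unfolding bessel_J_def bessel_entire_def using suminf_mult[OF summable_bessel] by simp
qed

lemma bessel_J_deriv_up:
  assumes "x > 0"
  shows "(bessel_J s has_real_derivative s / x * bessel_J s x - bessel_J (s + 1) x) (at x)"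
proof -
  let ?f = "\<lambda>x. (x / 2) powr s * bessel_entire s (x\<^sup>2 / 4)"
  have "((\<lambda>x. bessel_entire s (x\<^sup>2 / 4)) has_real_derivative - bessel_entire (s + 1) (x\<^sup>2 / 4) * (x / 2)) (at x)"
    by (rule DERIV_chain2[OF bessel_entire_deriv]) (auto intro!: derivative_eq_intros)
  moreover have "((\<lambda>x. (x / 2) powr s) has_real_derivative s / x * (x / 2) powr s) (at x)"
    using assms by (auto intro!: derivative_eq_intros simp: powr_diff field_simps)
  ultimately have "(?f has_real_derivative (s / x * (x / 2) powr s) * bessel_entire s (x\<^sup>2 / 4) +
      (- bessel_entire (s + 1) (x\<^sup>2 / 4) * (x / 2)) * (x / 2) powr s) (at x)"
    by (intro DERIV_mult)
  also have "(s / x * (x / 2) powr s) * bessel_entire s (x\<^sup>2 / 4) +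
      (- bessel_entire (s + 1) (x\<^sup>2 / 4) * (x / 2)) * (x / 2) powr s = s / x * bessel_J s x - bessel_J (s + 1) x"
    using assms by (simp add: bessel_J_eq powr_add mult_ac)
  finally show ?thesis
    by (rule has_field_derivative_transform_within_open[where S = "{0<..}"])
      (use assms in \<open>auto simp: bessel_J_eq\<close>)
qed

lemma bessel_J_rec:
  assumes "x > 0"
  shows "bessel_J (s - 1) x + bessel_J (s + 1) x = 2 * s / x * bessel_J s x"
proof -
  have 1: "bessel_J (s - 1) x = (x/2) powr s * (2 / x) * bessel_entire (s - 1) (x\<^sup>2 / 4)"
    and 2: "bessel_J (s + 1) x = (x/2) powr s * (x / 2) * bessel_entire (s + 1) (x\<^sup>2 / 4)"
    using assms by (simp_all add: bessel_J_eq powr_add powr_diff)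
  show ?thesis
    unfolding 1 2 bessel_J_eq[OF assms, of s] bessel_entire_rec
    using assms by (simp add: field_simps power2_eq_square)
qed

lemma bessel_J_deriv_down:
  assumes "x > 0"
  shows "(bessel_J s has_real_derivative bessel_J (s - 1) x - s / x * bessel_J s x) (at x)"
proof -
  have "bessel_J (s - 1) x = 2 * (s / x * bessel_J s x) - bessel_J (s + 1) x"
    using bessel_J_rec[OF assms, of s] by simp
  then have "s / x * bessel_J s x - bessel_J (s + 1) x = bessel_J (s - 1) x - s / x * bessel_J s x"
    by simp
  with bessel_J_deriv_up[OF assms, of s] show ?thesis by metis
qed

lemma bessel_J_deriv:
  assumes "x > 0"
  shows "(bessel_J s has_real_derivative (bessel_J (s - 1) x - bessel_J (s + 1) x) / 2) (at x)"
proof -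
  have "bessel_J (s - 1) x = 2 * (s / x * bessel_J s x) - bessel_J (s + 1) x"
    using bessel_J_rec[OF assms, of s] by simp
  then have "s / x * bessel_J s x - bessel_J (s + 1) x = (bessel_J (s - 1) x - bessel_J (s + 1) x) / 2"
    by simp
  with bessel_J_deriv_up[OF assms, of s] show ?thesis by metis
qed

text \<open>
  An energy estimate. For \<open>u = sqrt x J_s\<close>, \<open>v = sqrt x J_(s+1)\<close> and \<open>c = s + 1/2\<close> the recurrences give
  \<open>u' = (c/x) u - v\<close> and \<open>v' = u - (c/x) v\<close>. The derivative of \<open>u^2 + v^2\<close> is only \<open>O(1/x)\<close> relative
  to it, which is not integrable, but it equals \<open>(2c/x) (uv)'\<close>; subtracting \<open>(2c/x) uv\<close> therefore
  leaves the relative error \<open>O(1/x^2)\<close>. So \<open>E\<close> is comparable to \<open>u^2 + v^2\<close> and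
  \<open>E exp(2|c|/x)\<close> is nonincreasing for large \<open>x\<close>.
\<close>

lemma bessel_J_decay:
  assumes "d > 0"
  shows "\<exists>C\<ge>0. \<forall>x\<ge>d. \<bar>bessel_J s x\<bar> \<le> C * x powr (- 1 / 2)"
proof -
  define c where "c = s + 1 / 2"
  define u where "u x = sqrt x * bessel_J s x" for x
  define v where "v x = sqrt x * bessel_J (s + 1) x" for x
  define E where "E x = (u x)\<^sup>2 + (v x)\<^sup>2 - 2 * c / x * (u x * v x)" for x
  have du: "(u has_real_derivative c / x * u x - v x) (at x)" if "x > 0" for x
    unfolding u_def[abs_def] v_def c_def using that
    by (auto intro!: derivative_eq_intros bessel_J_deriv_up simp: field_simps)
  have dv: "(v has_real_derivative u x - c / x * v x) (at x)" if "x > 0" for x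
    unfolding u_def v_def[abs_def] c_def using that
    by (auto intro!: derivative_eq_intros bessel_J_deriv_down simp: field_simps)
  have dE: "(E has_real_derivative 2 * c / x\<^sup>2 * (u x * v x)) (at x)" if "x > 0" for x
    unfolding E_def[abs_def] using that
    by (auto intro!: derivative_eq_intros du dv simp: field_simps power2_eq_square)
  \<comment> \<open>From \<open>2|c|\<close> on, the correction term is at most half of \<open>u^2 + v^2\<close>.\<close>
  define x0 where "x0 = max d (2 * \<bar>c\<bar>)"
  have x0: "x0 > 0" "x0 \<ge> d" "x0 \<ge> 2 * \<bar>c\<bar>" using assms by (auto simp: x0_def)
  have uv: "\<bar>2 * (u x * v x)\<bar> \<le> (u x)\<^sup>2 + (v x)\<^sup>2" for x
  proof -
    have "0 \<le> (u x - v x)\<^sup>2" "0 \<le> (u x + v x)\<^sup>2" by simp_all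
    then show ?thesis by (simp add: power2_eq_square algebra_simps abs_le_iff)
  qed
  have Eu: "(u x)\<^sup>2 + (v x)\<^sup>2 \<le> 2 * E x" if "x \<ge> x0" for x
  proof -
    have "\<bar>c / x\<bar> \<le> 1 / 2" using that x0 by (simp add: field_simps)
    then have "\<bar>c / x\<bar> * \<bar>2 * (u x * v x)\<bar> \<le> 1 / 2 * ((u x)\<^sup>2 + (v x)\<^sup>2)"
      by (intro mult_mono uv) auto
    then have "c / x * (2 * (u x * v x)) \<le> 1 / 2 * ((u x)\<^sup>2 + (v x)\<^sup>2)"
      by (simp only: abs_mult[symmetric])
    then show ?thesis by (simp add: E_def field_simps)
  qed
  define W where "W x = E x * exp (2 * \<bar>c\<bar> / x)" for x
  have dW: "(W has_real_derivative (2 * c / x\<^sup>2 * (u x * v x) - 2 * \<bar>c\<bar> / x\<^sup>2 * E x) * exp (2 * \<bar>c\<bar> / x)) (at x)"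
    if "x > 0" for x
    unfolding W_def[abs_def] using that
    by (auto intro!: derivative_eq_intros dE simp: field_simps power2_eq_square)
  have W_le: "W x \<le> W x0" if "x \<ge> x0" for x
  proof (rule DERIV_nonpos_imp_nonincreasing[OF that])
    fix y assume y: "x0 \<le> y" "y \<le> x"
    have "c / y\<^sup>2 * (2 * (u y * v y)) \<le> \<bar>c / y\<^sup>2\<bar> * \<bar>2 * (u y * v y)\<bar>"
      by (simp only: abs_mult[symmetric] abs_ge_self)
    also have "\<dots> \<le> \<bar>c / y\<^sup>2\<bar> * (2 * E y)"
      using uv[of y] Eu[OF y(1)] by (intro mult_left_mono) auto
    finally have "2 * c / y\<^sup>2 * (u y * v y) - 2 * \<bar>c\<bar> / y\<^sup>2 * E y \<le> 0" by (simp add: mult_ac)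
    then show "\<exists>D. (W has_real_derivative D) (at y) \<and> D \<le> 0"
      using dW[of y] x0 y by (intro exI conjI) (auto intro: mult_nonpos_nonneg)
  qed
  have bd: "\<bar>u x\<bar> \<le> sqrt (2 * W x0)" if "x \<ge> x0" for x
  proof -
    have "0 \<le> E x" using Eu[OF that] sum_power2_ge_zero[of "u x" "v x"] by linarith
    then have "E x * 1 \<le> E x * exp (2 * \<bar>c\<bar> / x)"
      using that x0 by (intro mult_left_mono) auto
    then have "(u x)\<^sup>2 \<le> 2 * W x0"
      using Eu[OF that] W_le[OF that] zero_le_power2[of "v x"] unfolding W_def by linarith
    then show ?thesis by (simp add: real_le_rsqrt)
  qed
  have "continuous_on {d..x0} u"
    using assms by (intro continuous_at_imp_continuous_on ballI) (rule DERIV_isCont[OF du], auto)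
  then have "bounded (u ` {d..x0})"
    by (intro compact_imp_bounded compact_continuous_image) auto
  then obtain C1 where C1: "\<And>x. x \<in> {d..x0} \<Longrightarrow> \<bar>u x\<bar> \<le> C1"
    unfolding bounded_iff real_norm_def by blast
  define C where "C = max 0 (max C1 (sqrt (2 * W x0)))"
  have "\<bar>bessel_J s x\<bar> \<le> C * x powr (- 1 / 2)" if "x \<ge> d" for x
  proof -
    have "\<bar>u x\<bar> \<le> C"
      using C1[of x] bd[of x] that unfolding C_def by (cases "x \<le> x0") auto
    then have "sqrt x * \<bar>bessel_J s x\<bar> \<le> C" using that assms by (simp add: u_def abs_mult)
    then show ?thesis
      using that assms by (simp add: powr_minus powr_half_sqrt[symmetric] field_simps)
  qed
  moreover have "C \<ge> 0" by (simp add: C_def)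
  ultimately show ?thesis by blast
qed

section \<open>Functions with a decaying derivative\<close>

text \<open>
  Only the \<open>M\<close>-th derivative is bounded by \<open>x^q\<close>, on every half-line away from 0; near 0 the
  functions of interest are singular. The recursion makes the class closed under whatever
  produces a derivative explicitly, without mentioning iterated derivatives.
\<close>

fun smooth_decay :: "nat \<Rightarrow> real \<Rightarrow> (real \<Rightarrow> real) \<Rightarrow> bool" where
  "smooth_decay 0 q f \<longleftrightarrow> (\<forall>d>0. \<exists>C\<ge>0. \<forall>x\<ge>d. \<bar>f x\<bar> \<le> C * x powr q)"
| "smooth_decay (Suc M) q f \<longleftrightarrow>
     (\<exists>f'. (\<forall>x>0. (f has_real_derivative f' x) (at x)) \<and> smooth_decay M q f')"

lemma smooth_decay_lincomb:
  assumes "smooth_decay M q f" "smooth_decay M q g"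
  shows "smooth_decay M q (\<lambda>x. a * f x + b * g x)"
  using assms
proof (induction M arbitrary: f g)
  case 0
  show ?case
    unfolding smooth_decay.simps
  proof (intro allI impI)
    fix d :: real assume "d > 0"
    with 0 obtain C C' where C: "C \<ge> 0" "C' \<ge> 0" "\<And>x. x \<ge> d \<Longrightarrow> \<bar>f x\<bar> \<le> C * x powr q"
      "\<And>x. x \<ge> d \<Longrightarrow> \<bar>g x\<bar> \<le> C' * x powr q"
      unfolding smooth_decay.simps by meson
    have "\<bar>a * f x + b * g x\<bar> \<le> (\<bar>a\<bar> * C + \<bar>b\<bar> * C') * x powr q" if "x \<ge> d" for x
    proof -
      have "\<bar>a * f x + b * g x\<bar> \<le> \<bar>a\<bar> * \<bar>f x\<bar> + \<bar>b\<bar> * \<bar>g x\<bar>"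
        by (simp only: abs_mult[symmetric] abs_triangle_ineq)
      also have "\<dots> \<le> \<bar>a\<bar> * (C * x powr q) + \<bar>b\<bar> * (C' * x powr q)"
        using C that by (intro add_mono mult_left_mono) auto
      finally show ?thesis by (simp add: algebra_simps)
    qed
    with C show "\<exists>C\<ge>0. \<forall>x\<ge>d. \<bar>a * f x + b * g x\<bar> \<le> C * x powr q"
      by (intro exI[of _ "\<bar>a\<bar> * C + \<bar>b\<bar> * C'"]) auto
  qed
next
  case (Suc M)
  from Suc.prems obtain f' g' where
    *: "\<And>x. x > 0 \<Longrightarrow> (f has_real_derivative f' x) (at x)" "smooth_decay M q f'"
       "\<And>x. x > 0 \<Longrightarrow> (g has_real_derivative g' x) (at x)" "smooth_decay M q g'"
    by auto
  show ?case
    unfolding smooth_decay.simps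
  proof (intro exI conjI allI impI)
    show "smooth_decay M q (\<lambda>x. a * f' x + b * g' x)" using * by (intro Suc.IH)
    show "((\<lambda>x. a * f x + b * g x) has_real_derivative a * f' x + b * g' x) (at x)" if "x > 0" for x
      using *(1,3)[OF that] by (auto intro!: derivative_eq_intros)
  qed
qed

lemma smooth_decay_family:
  assumes "smooth_decay M q f"
  obtains g where "g 0 = f" "\<And>j x. j < M \<Longrightarrow> x > 0 \<Longrightarrow> (g j has_real_derivative g (Suc j) x) (at x)"
    "smooth_decay 0 q (g M)"
proof -
  have "\<exists>g. g 0 = f \<and> (\<forall>j<M. \<forall>x>0. (g j has_real_derivative g (Suc j) x) (at x)) \<and> smooth_decay 0 q (g M)"
    using assms
  proof (induction M arbitrary: f)
    case 0
    then show ?case by (intro exI[of _ "\<lambda>_. f"]) auto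
  next
    case (Suc M)
    then obtain f' where f': "\<forall>x>0. (f has_real_derivative f' x) (at x)" "smooth_decay M q f'" by auto
    from Suc.IH[OF f'(2)] obtain g where g: "g 0 = f'"
      "\<forall>j<M. \<forall>x>0. (g j has_real_derivative g (Suc j) x) (at x)" "smooth_decay 0 q (g M)" by blast
    show ?case
      by (rule exI[of _ "case_nat f g"]) (use f'(1) g in \<open>auto split: nat.split simp del: smooth_decay.simps\<close>)
  qed
  then show ?thesis using that by blast
qed

text \<open>
  The gain of \<open>a^(-M)\<close> over the size of \<open>(x/a)^q\<close> is what makes the far part of the sum negligible:
  \<open>q\<close> does not depend on \<open>M\<close>.
\<close>

lemma smooth_decay_fdiff:
  assumes "smooth_decay M q f" "q \<le> 0" "d > 0"
  shows "\<exists>C\<ge>0. \<forall>a>0. \<forall>x\<ge>d * a. \<bar>(fdiff ^^ M) (\<lambda>x. f (x / a)) x\<bar> \<le> C * a powr (- real M - q) * x powr q"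
proof -
  obtain g where g: "g 0 = f" "\<And>j x. j < M \<Longrightarrow> x > 0 \<Longrightarrow> (g j has_real_derivative g (Suc j) x) (at x)"
    "smooth_decay 0 q (g M)" using smooth_decay_family[OF assms(1)] by blast
  from g(3) assms(3) obtain C where C: "C \<ge> 0" "\<And>x. x \<ge> d \<Longrightarrow> \<bar>g M x\<bar> \<le> C * x powr q"
    unfolding smooth_decay.simps by blast
  have "\<bar>(fdiff ^^ M) (\<lambda>x. f (x / a)) x\<bar> \<le> C * a powr (- real M - q) * x powr q"
    if a: "a > 0" and x: "x \<ge> d * a" for a x
  proof -
    define G where "G j t = g j (t / a) / a ^ j" for j t
    have x0: "x > 0" using a x assms(3) by (metis mult_pos_pos less_le_trans)
    have "norm ((fdiff ^^ M) (G 0) x) \<le> C * a powr (- real M - q) * x powr q"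
    proof (rule norm_fdiff_pow_le)
      fix j t assume j: "j < M" and t: "t \<in> {x..x + real M}"
      then have "t / a > 0" using x0 a by auto
      from g(2)[OF j this] have "((\<lambda>t. g j (t / a)) has_real_derivative g (Suc j) (t / a) * (1 / a)) (at t)"
        by (rule DERIV_chain2) (use a in \<open>auto intro!: derivative_eq_intros\<close>)
      then have "(G j has_real_derivative g (Suc j) (t / a) * (1 / a) / a ^ j) (at t)"
        unfolding G_def[abs_def] by (rule DERIV_cdivide)
      then show "(G j has_vector_derivative G (Suc j) t) (at t)"
        by (simp add: G_def has_real_derivative_iff_has_vector_derivative field_simps)
    next
      fix t assume t: "t \<in> {x..x + real M}"
      have "t / a \<ge> d" using t x a by (simp add: field_simps)
      from C(2)[OF this] have "\<bar>g M (t / a)\<bar> \<le> C * (t / a) powr q" .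
      also have "\<dots> \<le> C * (x / a) powr q"
        using t x0 a assms(2) C(1) by (intro mult_left_mono powr_mono2' divide_right_mono) auto
      finally have "\<bar>g M (t / a)\<bar> / a ^ M \<le> C * (x / a) powr q / a ^ M"
        using a by (intro divide_right_mono) auto
      also have "\<dots> = C * a powr (- real M - q) * x powr q"
        using a x0 by (simp add: powr_divide powr_diff powr_minus powr_realpow field_simps)
      finally show "norm (G M t) \<le> C * a powr (- real M - q) * x powr q"
        using a by (simp add: G_def)
    qed
    then show ?thesis by (simp add: G_def[abs_def] g(1))
  qed
  with C(1) show ?thesis by blast
qed

section \<open>Asymptotic expansion of alternating sums\<close>

lemma abs_falling_le: "\<bar>falling (s::real) j\<bar> \<le> (\<bar>s\<bar> + real j) ^ j"
proof -
  have "\<bar>falling s j\<bar> = (\<Prod>i<j. \<bar>s - real i\<bar>)" by (simp add: falling_def abs_prod)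
  also have "\<dots> \<le> (\<Prod>i<j. \<bar>s\<bar> + real j)" by (intro prod_mono) auto
  finally show ?thesis by simp
qed

lemma summable_poly_geometric: "summable (\<lambda>k. (D + 2 * real k) ^ j * (1 / 2) ^ k)"
proof -
  have "(\<lambda>k. (D + 2 * real k) ^ j * (1 / 2) ^ k) \<in> O(\<lambda>k. (3 / 4) ^ k)"
  proof -
    have 1: "(\<lambda>k. (D + 2 * real k) ^ j) \<in> O(\<lambda>k. (real k + 1) ^ j)"
      by (intro landau_o.big_power) real_asymp
    have 2: "(\<lambda>k. (real k + 1) ^ j * (1 / 2) ^ k) \<in> O(\<lambda>k. (3 / 4) ^ k)"
      by real_asymp
    have "(\<lambda>k. (D + 2 * real k) ^ j * (1 / 2) ^ k) \<in> O(\<lambda>k. (real k + 1) ^ j * (1 / 2) ^ k)"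
      by (intro landau_o.big.mult 1) auto
    with 2 show ?thesis by (rule landau_o.big_trans[rotated])
  qed
  then show ?thesis
    by (rule summable_comparison_test_bigo[rotated]) (simp add: summable_geometric)
qed

lemma euler_sum_diff_sum:
  fixes f :: "real \<Rightarrow> real"
  assumes "summable (\<lambda>n. (-1) ^ n * (fdiff ^^ M) f (real n + 1))"
    and "\<And>k. k \<in> A \<Longrightarrow> summable (\<lambda>n. (-1) ^ n * (fdiff ^^ M) (g k) (real n + 1))"
  shows "euler_sum M (\<lambda>x. f x - (\<Sum>k\<in>A. c k * g k x)) = euler_sum M f - (\<Sum>k\<in>A. c k * euler_sum M (g k))"
proof -
  have D: "(fdiff ^^ j) (\<lambda>x. f x - (\<Sum>k\<in>A. c k * g k x)) x = (fdiff ^^ j) f x - (\<Sum>k\<in>A. c k * (fdiff ^^ j) (g k) x)" for j x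
    by (simp add: fdiff_pow_diff fdiff_pow_sum fdiff_pow_linear[OF bounded_linear_mult_right])
  have "(\<lambda>n. (-1) ^ n * (fdiff ^^ M) f (real n + 1) - (\<Sum>k\<in>A. c k * ((-1) ^ n * (fdiff ^^ M) (g k) (real n + 1)))) sums
     ((\<Sum>n. (-1) ^ n * (fdiff ^^ M) f (real n + 1)) - (\<Sum>k\<in>A. c k * (\<Sum>n. (-1) ^ n * (fdiff ^^ M) (g k) (real n + 1))))"
    using assms by (intro sums_diff sums_sum sums_mult summable_sums)
  then have E1: "(\<Sum>n. (-1) ^ n * (fdiff ^^ M) (\<lambda>x. f x - (\<Sum>k\<in>A. c k * g k x)) (real n + 1)) =
     (\<Sum>n. (-1) ^ n * (fdiff ^^ M) f (real n + 1)) - (\<Sum>k\<in>A. c k * (\<Sum>n. (-1) ^ n * (fdiff ^^ M) (g k) (real n + 1)))"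
    by (simp add: D sums_iff right_diff_distrib sum_distrib_left mult_ac)
  have E2: "(\<Sum>j<M. (1 / 2) ^ Suc j * (fdiff ^^ j) (\<lambda>x. f x - (\<Sum>k\<in>A. c k * g k x)) 1) =
     (\<Sum>j<M. (1 / 2) ^ Suc j * (fdiff ^^ j) f 1) - (\<Sum>k\<in>A. c k * (\<Sum>j<M. (1 / 2) ^ Suc j * (fdiff ^^ j) (g k) 1))"
    by (simp add: D right_diff_distrib sum_subtractf sum_distrib_left mult_ac sum.swap[of _ _ A])
  have lin: "(\<Sum>k\<in>A. c k * (a k + h * b k)) = (\<Sum>k\<in>A. c k * a k) + h * (\<Sum>k\<in>A. c k * b k)"
    for a b :: "_ \<Rightarrow> real" and h
    by (simp add: distrib_left sum.distrib sum_distrib_left mult.left_commute)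
  have alg: "(x - y) + h * (z - w) = x + h * z - (y + h * w)" for x y z w h :: real
    by (simp add: algebra_simps)
  show ?thesis
    unfolding euler_sum_def real_scaleR_def E1 E2 lin by (rule alg)
qed

lemma abs_euler_sum_le:
  fixes F :: "real \<Rightarrow> real"
  assumes "\<And>j. j < M \<Longrightarrow> \<bar>(fdiff ^^ j) F 1\<bar> \<le> A j"
    and "\<And>n. \<bar>(fdiff ^^ M) F (real n + 1)\<bar> \<le> B n" "summable B"
  shows "\<bar>euler_sum M F\<bar> \<le> (\<Sum>j<M. A j) + (\<Sum>n. B n)"
proof -
  have "\<bar>\<Sum>j<M. (1 / 2) ^ Suc j * (fdiff ^^ j) F 1\<bar> \<le> (\<Sum>j<M. A j)"
  proof (rule order_trans[OF sum_abs sum_mono])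
    fix j assume "j \<in> {..<M}"
    then have "\<bar>(fdiff ^^ j) F 1\<bar> \<le> A j" using assms(1) by simp
    moreover have "(1 / 2 :: real) ^ Suc j \<le> 1" by (intro power_le_one) auto
    ultimately have "(1 / 2) ^ Suc j * \<bar>(fdiff ^^ j) F 1\<bar> \<le> 1 * A j" by (intro mult_mono) auto
    then show "\<bar>(1 / 2) ^ Suc j * (fdiff ^^ j) F 1\<bar> \<le> A j" by (simp add: abs_mult)
  qed
  moreover have "\<bar>\<Sum>n. (-1) ^ n * (fdiff ^^ M) F (real n + 1)\<bar> \<le> (\<Sum>n. B n)"
    using norm_suminf_le[of "\<lambda>n. (-1) ^ n * (fdiff ^^ M) F (real n + 1)" B] assms(2,3) by (simp add: abs_mult)
  then have "(1 / 2) ^ M * \<bar>\<Sum>n. (-1) ^ n * (fdiff ^^ M) F (real n + 1)\<bar> \<le> 1 * (\<Sum>n. B n)"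
    by (intro mult_mono power_le_one) auto
  then have "\<bar>(1 / 2) ^ M * (\<Sum>n. (-1) ^ n * (fdiff ^^ M) F (real n + 1))\<bar> \<le> (\<Sum>n. B n)"
    by (simp add: abs_mult)
  ultimately show ?thesis
    unfolding euler_sum_def real_scaleR_def by (rule order_trans[OF abs_triangle_ineq add_mono])
qed

text \<open>
  For arguments up to \<open>a/2\<close> the remainder is the tail of the power series. The difference of each
  term \<open>H_k a^(-\<omega>_k) t^(\<omega>_k)\<close> is bounded separately: compared with \<open>k = K\<close> it carries an extra factor
  \<open>(1/4)^(k-K)\<close>, which beats the growth \<open>2^k\<close> of \<open>H_k\<close> and the polynomial growth of the falling
  factorials. Both endpoints of \<open>[x, x + j]\<close> appear in the bound since the sign of the exponent is
  arbitrary when \<open>j\<close> is small.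
\<close>

lemma series_tail_fdiff:
  fixes w B :: real and H :: "nat \<Rightarrow> real" and f :: "real \<Rightarrow> real"
  defines "r \<equiv> \<lambda>K a x. f (x / a) - (\<Sum>k<K. H k * a powr (- (w + 2 * real k)) * x powr (w + 2 * real k))"
  assumes ser: "\<And>x. 0 < x \<Longrightarrow> x < 1 \<Longrightarrow> (\<lambda>k. H k * x powr (w + 2 * real k)) sums f x"
    and B: "\<And>k. \<bar>H k\<bar> \<le> B * 2 ^ k"
  shows "\<exists>C\<ge>0. \<forall>a x. x > 0 \<longrightarrow> x + real j \<le> a / 2 \<longrightarrow>
     \<bar>(fdiff ^^ j) (r K a) x\<bar> \<le>
       C * a powr (- (w + 2 * real K)) * (x powr (w + 2 * real K - real j) + (x + real j) powr (w + 2 * real K - real j))"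
proof -
  have B0: "B \<ge> 0" using B[of 0] by simp
  define c where "c k = \<bar>H (k + K)\<bar> * \<bar>falling (w + 2 * real (k + K)) j\<bar> * (1 / 4) ^ k" for k
  have c0: "c k \<ge> 0" for k by (simp add: c_def)
  have "summable c"
  proof (rule summable_comparison_test')
    show "summable (\<lambda>k. B * 2 ^ K * ((\<bar>w\<bar> + 2 * real K + real j + 2 * real k) ^ j * (1 / 2) ^ k))"
      by (intro summable_mult summable_poly_geometric)
    show "norm (c k) \<le> B * 2 ^ K * ((\<bar>w\<bar> + 2 * real K + real j + 2 * real k) ^ j * (1 / 2) ^ k)" for k
    proof -
      have "\<bar>falling (w + 2 * real (k + K)) j\<bar> \<le> (\<bar>w + 2 * real (k + K)\<bar> + real j) ^ j" by (rule abs_falling_le)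
      also have "\<dots> \<le> (\<bar>w\<bar> + 2 * real K + real j + 2 * real k) ^ j" by (intro power_mono) auto
      finally have "c k \<le> (B * 2 ^ (k + K)) * (\<bar>w\<bar> + 2 * real K + real j + 2 * real k) ^ j * (1 / 4) ^ k"
        unfolding c_def using B B0 by (intro mult_mono) auto
      also have "\<dots> = B * 2 ^ K * ((\<bar>w\<bar> + 2 * real K + real j + 2 * real k) ^ j * (2 ^ k * (1 / 4) ^ k))"
        by (simp add: power_add)
      also have "(2::real) ^ k * (1 / 4) ^ k = (1 / 2) ^ k" by (simp add: power_mult_distrib[symmetric])
      finally show ?thesis using c0[of k] by simp
    qed
  qed
  have "\<bar>(fdiff ^^ j) (r K a) x\<bar> \<le>
       suminf c * a powr (- (w + 2 * real K)) * (x powr (w + 2 * real K - real j) + (x + real j) powr (w + 2 * real K - real j))"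
    (is "_ \<le> suminf c * ?a * ?P")
    if x: "x > 0" "x + real j \<le> a / 2" for a x
  proof -
    have a: "a > 0" using x by linarith
    define u where "u k t = H (k + K) * a powr (- (w + 2 * real (k + K))) * t powr (w + 2 * real (k + K))" for k t
    have "(\<lambda>k. u k t) sums r K a t" if t: "t \<in> {x..x + real j}" for t
    proof -
      have t0: "t > 0" "t / a > 0" "t / a < 1" using t x a by auto
      have *: "(t / a) powr e = a powr (- e) * t powr e" for e
        using t0 a by (simp add: powr_divide powr_minus field_simps)
      from ser[OF t0(2,3)] have "(\<lambda>k. H k * a powr (- (w + 2 * real k)) * t powr (w + 2 * real k)) sums f (t / a)"
        unfolding * by (simp add: mult.assoc)
      then show ?thesis unfolding u_def r_def by (subst sums_iff_shift) simp
    qed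
    then have sm: "(\<lambda>k. (fdiff ^^ j) (u k) x) sums (fdiff ^^ j) (r K a) x" by (rule fdiff_pow_sums)
    have bd: "norm ((fdiff ^^ j) (u k) x) \<le> c k * (?a * ?P)" for k
    proof -
      let ?e = "w + 2 * real (k + K)"
      have "(fdiff ^^ j) (u k) x = H (k + K) * a powr (- ?e) * (fdiff ^^ j) (\<lambda>t. t powr ?e) x"
        unfolding u_def[abs_def] by (rule fdiff_pow_linear[OF bounded_linear_mult_right])
      moreover have "\<bar>(fdiff ^^ j) (\<lambda>t. t powr ?e) x\<bar> \<le> \<bar>falling ?e j\<bar> * (?P * (a / 2) ^ (2 * k))"
      proof (rule abs_fdiff_powr_le[OF x(1)])
        fix t assume t: "t \<in> {x..x + real j}"
        have "?e - real j = (w + 2 * real K - real j) + real (2 * k)" by simp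
        then have "t powr (?e - real j) = t powr (w + 2 * real K - real j) * t powr real (2 * k)"
          by (simp only: powr_add)
        also have "t powr real (2 * k) = t ^ (2 * k)" using t x by (intro powr_realpow) auto
        also have "t powr (w + 2 * real K - real j) * t ^ (2 * k) \<le> ?P * (a / 2) ^ (2 * k)"
        proof (intro mult_mono power_mono)
          show "t powr (w + 2 * real K - real j) \<le> ?P"
          proof (cases "w + 2 * real K - real j \<ge> 0")
            case True
            then have "t powr (w + 2 * real K - real j) \<le> (x + real j) powr (w + 2 * real K - real j)"
              using t x by (intro powr_mono2) auto
            then show ?thesis by (simp add: add_increasing)
          next
            case False
            then have "t powr (w + 2 * real K - real j) \<le> x powr (w + 2 * real K - real j)"
              using t x by (intro powr_mono2') auto
            then show ?thesis by (simp add: add_increasing2)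
          qed
        qed (use t x in auto)
        finally show "t powr (?e - real j) \<le> ?P * (a / 2) ^ (2 * k)" .
      qed
      ultimately have "norm ((fdiff ^^ j) (u k) x) \<le> \<bar>H (k + K)\<bar> * a powr (- ?e) * (\<bar>falling ?e j\<bar> * (?P * (a / 2) ^ (2 * k)))"
        by (simp add: abs_mult mult_left_mono)
      also have "a powr (- ?e) = ?a * a powr (- real (2 * k))"
        by (simp add: powr_add[symmetric] algebra_simps)
      also have "a powr (- real (2 * k)) = inverse (a ^ (2 * k))"
        using a by (simp only: powr_minus powr_realpow)
      also have "\<bar>H (k + K)\<bar> * (?a * inverse (a ^ (2 * k))) * (\<bar>falling ?e j\<bar> * (?P * (a / 2) ^ (2 * k))) =
          \<bar>H (k + K)\<bar> * \<bar>falling ?e j\<bar> * (inverse (a ^ (2 * k)) * (a / 2) ^ (2 * k)) * (?a * ?P)"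
        by (simp only: mult_ac)
      also have "inverse (a ^ (2 * k)) * (a / 2) ^ (2 * k) = (1 / 4) ^ k"
        using a by (simp add: power_divide power_mult)
      finally show ?thesis by (simp only: c_def)
    qed
    have "norm (\<Sum>k. (fdiff ^^ j) (u k) x) \<le> (\<Sum>k. c k * (?a * ?P))"
      by (rule norm_suminf_le[OF bd]) (intro summable_mult2 \<open>summable c\<close>)
    also have "\<dots> = suminf c * (?a * ?P)" by (rule suminf_mult2[symmetric]) fact
    finally show ?thesis using sm by (simp add: sums_iff mult.assoc)
  qed
  moreover have "suminf c \<ge> 0" by (intro suminf_nonneg \<open>summable c\<close> c0)
  ultimately show ?thesis by blast
qed

text \<open>
  For \<open>x \<ge> a/4\<close> there is no cancellation between \<open>f(x/a)\<close> and the partial sum, and none is needed: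
  after \<open>M\<close> differences each power \<open>(x/a)^(\<omega>_k)\<close> with \<open>k < K\<close> is dominated by the one with
  exponent \<open>\<omega>_K\<close>, because \<open>x/a\<close> is bounded below.
\<close>

lemma series_far_fdiff:
  fixes w q :: real and H :: "nat \<Rightarrow> real" and f :: "real \<Rightarrow> real"
  defines "r \<equiv> \<lambda>K a x. f (x / a) - (\<Sum>k<K. H k * a powr (- (w + 2 * real k)) * x powr (w + 2 * real k))"
  assumes f: "smooth_decay M q f" and q: "q \<le> 0" and M: "w + 2 * real K \<le> real M"
  shows "\<exists>C\<ge>0. \<forall>a>0. \<forall>x\<ge>a / 4. \<bar>(fdiff ^^ M) (r K a) x\<bar> \<le>
       C * (a powr (- real M - q) * x powr q + a powr (- (w + 2 * real K)) * x powr (w + 2 * real K - real M))"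
proof -
  obtain C1 where C1: "C1 \<ge> 0" "\<And>a x. a > 0 \<Longrightarrow> x \<ge> 1 / 4 * a \<Longrightarrow>
      \<bar>(fdiff ^^ M) (\<lambda>x. f (x / a)) x\<bar> \<le> C1 * a powr (- real M - q) * x powr q"
    using smooth_decay_fdiff[OF f q, of "1 / 4"] by auto
  define c where "c k = \<bar>H k\<bar> * \<bar>falling (w + 2 * real k) M\<bar> * (1 / 4) powr (2 * real k - 2 * real K)" for k
  define C where "C = C1 + (\<Sum>k<K. c k)"
  have c0: "c k \<ge> 0" for k by (simp add: c_def)
  then have C: "C \<ge> C1" "C \<ge> (\<Sum>k<K. c k)" using C1(1) by (simp_all add: C_def sum_nonneg)
  have "\<bar>(fdiff ^^ M) (r K a) x\<bar> \<le>
       C * (a powr (- real M - q) * x powr q + a powr (- (w + 2 * real K)) * x powr (w + 2 * real K - real M))"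
    (is "_ \<le> C * (?X + ?Y)")
    if a: "a > 0" and x: "x \<ge> a / 4" for a x
  proof -
    have x0: "x > 0" using a x by linarith
    let ?t = "\<lambda>k x. H k * a powr (- (w + 2 * real k)) * x powr (w + 2 * real k)"
    have term_le: "\<bar>(fdiff ^^ M) (?t k) x\<bar> \<le> c k * ?Y" if k: "k < K" for k
    proof -
      let ?e = "w + 2 * real k"
      have e: "?e - real M \<le> 0" using k M by (smt (verit) of_nat_less_iff)
      have "(fdiff ^^ M) (?t k) x = H k * a powr (- ?e) * (fdiff ^^ M) (\<lambda>t. t powr ?e) x"
        by (rule fdiff_pow_linear[OF bounded_linear_mult_right])
      moreover have "\<bar>(fdiff ^^ M) (\<lambda>t. t powr ?e) x\<bar> \<le> \<bar>falling ?e M\<bar> * x powr (?e - real M)"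
        by (rule abs_fdiff_powr_le[OF x0]) (use e x0 in \<open>auto intro!: powr_mono2'\<close>)
      ultimately have "\<bar>(fdiff ^^ M) (?t k) x\<bar> \<le> \<bar>H k\<bar> * a powr (- ?e) * (\<bar>falling ?e M\<bar> * x powr (?e - real M))"
        by (simp add: abs_mult mult_left_mono)
      also have "x powr (?e - real M) = x powr (2 * real k - 2 * real K) * x powr (w + 2 * real K - real M)"
        by (simp add: powr_add[symmetric] algebra_simps)
      also have "\<bar>H k\<bar> * a powr (- ?e) * (\<bar>falling ?e M\<bar> * (x powr (2 * real k - 2 * real K) * x powr (w + 2 * real K - real M)))
        \<le> \<bar>H k\<bar> * a powr (- ?e) * (\<bar>falling ?e M\<bar> * ((a * (1 / 4)) powr (2 * real k - 2 * real K) * x powr (w + 2 * real K - real M)))"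
        using k a x by (intro mult_left_mono mult_right_mono powr_mono2') auto
      also have "(a * (1 / 4)) powr (2 * real k - 2 * real K) = a powr (2 * real k - 2 * real K) * (1 / 4) powr (2 * real k - 2 * real K)"
        by (rule powr_mult)
      also have "\<bar>H k\<bar> * a powr (- ?e) * (\<bar>falling ?e M\<bar> * (a powr (2 * real k - 2 * real K) * (1 / 4) powr (2 * real k - 2 * real K) * x powr (w + 2 * real K - real M)))
        = c k * ((a powr (- ?e) * a powr (2 * real k - 2 * real K)) * x powr (w + 2 * real K - real M))"
        unfolding c_def by (simp only: mult_ac)
      also have "a powr (- ?e) * a powr (2 * real k - 2 * real K) = a powr (- (w + 2 * real K))"
        by (simp add: powr_add[symmetric] algebra_simps)
      finally show ?thesis .
    qed
    have split: "(fdiff ^^ M) (r K a) x = (fdiff ^^ M) (\<lambda>x. f (x / a)) x - (\<Sum>k<K. (fdiff ^^ M) (?t k) x)"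
      unfolding r_def by (simp only: fdiff_pow_diff fdiff_pow_sum)
    have "\<bar>\<Sum>k<K. (fdiff ^^ M) (?t k) x\<bar> \<le> (\<Sum>k<K. c k * ?Y)"
      by (rule order_trans[OF sum_abs sum_mono]) (rule term_le, simp)
    moreover have "\<bar>(fdiff ^^ M) (\<lambda>x. f (x / a)) x\<bar> \<le> C1 * ?X"
      using C1(2)[OF a, of x] x by (simp add: mult.assoc)
    ultimately have "\<bar>(fdiff ^^ M) (r K a) x\<bar> \<le> C1 * ?X + (\<Sum>k<K. c k) * ?Y"
      unfolding split sum_distrib_right by linarith
    also have "\<dots> \<le> C * ?X + C * ?Y"
      using C by (intro add_mono mult_right_mono) auto
    finally show ?thesis by (simp add: distrib_left)
  qed
  moreover have "C \<ge> 0" using C(1) C1(1) by linarith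
  ultimately show ?thesis by blast
qed

text \<open>
  The two conditions on \<open>M\<close> have different origins: the first makes \<open>\<Sum>n. n^(\<omega>_K - M)\<close> converge, the
  second makes the far contribution \<open>a^(-M-q)\<close> no larger than \<open>a^(-\<omega>_K)\<close>.
\<close>

lemma euler_sum_remainder_bigo:
  fixes w q B :: real and H :: "nat \<Rightarrow> real" and f :: "real \<Rightarrow> real"
  defines "r \<equiv> \<lambda>K a x. f (x / a) - (\<Sum>k<K. H k * a powr (- (w + 2 * real k)) * x powr (w + 2 * real k))"
  assumes ser: "\<And>x. 0 < x \<Longrightarrow> x < 1 \<Longrightarrow> (\<lambda>k. H k * x powr (w + 2 * real k)) sums f x"
    and B: "\<And>k. \<bar>H k\<bar> \<le> B * 2 ^ k"
    and f: "smooth_decay M q f" and q: "q < -1"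
    and M: "real M > w + 2 * real K + 1" "real M \<ge> w + 2 * real K - q"
  shows "(\<lambda>a. euler_sum M (r K a)) \<in> O[at_top](\<lambda>a. a powr (- (w + 2 * real K)))"
proof -
  let ?e = "w + 2 * real K"
  have "\<forall>j. \<exists>C\<ge>0. \<forall>a x. x > 0 \<longrightarrow> x + real j \<le> a / 2 \<longrightarrow> \<bar>(fdiff ^^ j) (r K a) x\<bar> \<le>
       C * a powr (- ?e) * (x powr (?e - real j) + (x + real j) powr (?e - real j))"
    unfolding r_def by (intro allI series_tail_fdiff[OF ser B])
  from choice[OF this] obtain C where C: "\<And>j. C j \<ge> 0" "\<And>j a x. x > 0 \<Longrightarrow> x + real j \<le> a / 2 \<Longrightarrow>
      \<bar>(fdiff ^^ j) (r K a) x\<bar> \<le> C j * a powr (- ?e) * (x powr (?e - real j) + (x + real j) powr (?e - real j))"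
    by blast
  obtain C' where C': "C' \<ge> 0" "\<And>a x. a > 0 \<Longrightarrow> x \<ge> a / 4 \<Longrightarrow> \<bar>(fdiff ^^ M) (r K a) x\<bar> \<le>
       C' * (a powr (- real M - q) * x powr q + a powr (- ?e) * x powr (?e - real M))"
    using series_far_fdiff[OF f, of w K H] q M unfolding r_def by auto
  define A where "A j = C j * (1 powr (?e - real j) + (1 + real j) powr (?e - real j))" for j
  define S where "S n = (2 * C M + C') * ((real n + 1) powr q + (real n + 1) powr (?e - real M))" for n
  have S: "summable S"
    unfolding S_def using q M by (intro summable_mult summable_add summable_real_powr_plus1) auto
  have "\<bar>euler_sum M (r K a)\<bar> \<le> ((\<Sum>j<M. A j) + (\<Sum>n. S n)) * a powr (- ?e)"
    if a: "a \<ge> 4 * (real M + 1)" for a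
  proof -
    have "\<bar>euler_sum M (r K a)\<bar> \<le> (\<Sum>j<M. A j * a powr (- ?e)) + (\<Sum>n. S n * a powr (- ?e))"
    proof (rule abs_euler_sum_le)
      show "\<bar>(fdiff ^^ j) (r K a) 1\<bar> \<le> A j * a powr (- ?e)" if "j < M" for j
        using C(2)[of 1 j a] that a by (simp add: A_def mult_ac)
      show "summable (\<lambda>n. S n * a powr (- ?e))" by (intro summable_mult2 S)
      show "\<bar>(fdiff ^^ M) (r K a) (real n + 1)\<bar> \<le> S n * a powr (- ?e)" for n
      proof (cases "real n + 1 \<le> a / 4")
        case True
        let ?x = "real n + 1"
        have mono: "(?x + real M) powr (?e - real M) \<le> ?x powr (?e - real M)"
          using M(1) by (intro powr_mono2') auto
        have "\<bar>(fdiff ^^ M) (r K a) ?x\<bar> \<le> C M * a powr (- ?e) * (?x powr (?e - real M) + (?x + real M) powr (?e - real M))"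
          using True a by (intro C(2)) auto
        also have "\<dots> \<le> C M * a powr (- ?e) * (?x powr (?e - real M) + ?x powr (?e - real M))"
          using C(1) mono by (intro mult_left_mono) auto
        also have "\<dots> = (2 * C M) * ?x powr (?e - real M) * a powr (- ?e)" by simp
        also have "\<dots> \<le> S n * a powr (- ?e)"
          unfolding S_def using C(1)[of M] C'(1) by (intro mult_right_mono mult_mono) auto
        finally show ?thesis .
      next
        case False
        let ?x = "real n + 1"
        have a1: "a \<ge> 1" using a by simp
        have "\<bar>(fdiff ^^ M) (r K a) ?x\<bar> \<le> C' * (a powr (- real M - q) * ?x powr q + a powr (- ?e) * ?x powr (?e - real M))"
          using False a1 by (intro C'(2)) auto
        also have "\<dots> \<le> C' * (a powr (- ?e) * ?x powr q + a powr (- ?e) * ?x powr (?e - real M))"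
          using C'(1) M(2) a1 by (intro mult_left_mono add_mono mult_right_mono powr_mono) auto
        also have "\<dots> = C' * (?x powr q + ?x powr (?e - real M)) * a powr (- ?e)" by (simp add: algebra_simps)
        also have "\<dots> \<le> S n * a powr (- ?e)"
          unfolding S_def using C(1)[of M] C'(1) by (intro mult_right_mono) auto
        finally show ?thesis .
      qed
    qed
    also have "\<dots> = ((\<Sum>j<M. A j) + (\<Sum>n. S n)) * a powr (- ?e)"
      using suminf_mult2[OF S, of "a powr (- ?e)"] by (simp add: sum_distrib_right distrib_right)
    finally show ?thesis .
  qed
  note bound = this
  have "\<forall>\<^sub>F a in at_top. norm (euler_sum M (r K a)) \<le>
      ((\<Sum>j<M. A j) + (\<Sum>n. S n)) * norm (a powr (- ?e))"
  proof (rule eventually_mono)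
    show "\<forall>\<^sub>F a in at_top. a \<ge> 4 * (real M + 1)" by (rule eventually_ge_at_top)
    show "norm (euler_sum M (r K a)) \<le> ((\<Sum>j<M. A j) + (\<Sum>n. S n)) * norm (a powr (- ?e))"
      if "a \<ge> 4 * (real M + 1)" for a
      unfolding real_norm_def abs_of_nonneg[OF powr_ge_zero] by (rule bound[OF that])
  qed
  then show ?thesis
    by (intro bigoI[where f = "\<lambda>a. euler_sum M (r K a)" and g = "\<lambda>a. a powr (- (w + 2 * real K))"
          and c = "(\<Sum>j<M. A j) + (\<Sum>n. S n)"])
qed

text \<open>
  The sum of \<open>(-1)^n f((n+1)/a)\<close> may be expanded by inserting the series of \<open>f\<close> at 0 and replacing
  each divergent sum of powers by its eta value. Summability makes the left-hand side an Euler sum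
  for every \<open>M\<close>, so \<open>M\<close> can be chosen after \<open>K\<close>.
\<close>

theorem alternating_sum_expansion:
  fixes w q B :: real and H :: "nat \<Rightarrow> real" and f :: "real \<Rightarrow> real"
  assumes ser: "\<And>x. 0 < x \<Longrightarrow> x < 1 \<Longrightarrow> (\<lambda>k. H k * x powr (w + 2 * real k)) sums f x"
    and B: "\<And>k. \<bar>H k\<bar> \<le> B * 2 ^ k"
    and f: "\<And>M. smooth_decay M q f" and q: "q < -1"
    and w: "\<And>k::nat. w + 2 * real k \<noteq> -1"
  shows "\<And>a. a > 0 \<Longrightarrow> summable (\<lambda>n. (-1) ^ n * f (real (Suc n) / a))"
    and "(\<lambda>a. (\<Sum>n. (-1) ^ n * f (real (Suc n) / a)) -
           (\<Sum>k<K. H k * ((1 - 2 powr (1 + (w + 2 * real k))) * Re (zeta (of_real (- (w + 2 * real k))))) *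
              a powr (- (w + 2 * real k)))) \<in> O[at_top](\<lambda>a. a powr (- (w + 2 * real K)))"
proof -
  show summable: "summable (\<lambda>n. (-1) ^ n * f (real (Suc n) / a))" if a: "a > 0" for a
  proof -
    from a have "1 / a > 0" by simp
    with f[of 0] obtain C where C: "C \<ge> 0" "\<And>x. x \<ge> 1 / a \<Longrightarrow> \<bar>f x\<bar> \<le> C * x powr q"
      unfolding smooth_decay.simps by blast
    show ?thesis
    proof (rule summable_comparison_test')
      show "summable (\<lambda>n. C * a powr (- q) * (real n + 1) powr q)"
        using q by (intro summable_mult summable_real_powr_plus1) auto
      fix n
      have "\<bar>f (real (Suc n) / a)\<bar> \<le> C * (real (Suc n) / a) powr q"
        using a by (intro C(2)) (auto simp: field_simps)
      also have "\<dots> = C * a powr (- q) * (real n + 1) powr q"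
        using a by (subst powr_divide) (auto simp: powr_minus field_simps)
      finally show "norm ((-1) ^ n * f (real (Suc n) / a)) \<le> C * a powr (- q) * (real n + 1) powr q"
        by (simp add: abs_mult)
    qed
  qed
  \<comment> \<open>Any \<open>M\<close> beyond both thresholds of the remainder estimate will do.\<close>
  obtain M :: nat where "real M \<ge> max (w + 2 * real K + 2) (w + 2 * real K - q)"
    using real_arch_simple by blast
  then have M: "real M > w + 2 * real K + 1" "real M \<ge> w + 2 * real K - q" by auto
  let ?r = "\<lambda>a x. f (x / a) - (\<Sum>k<K. H k * a powr (- (w + 2 * real k)) * x powr (w + 2 * real k))"
  have "euler_sum M (?r a) = (\<Sum>n. (-1) ^ n * f (real (Suc n) / a)) -
           (\<Sum>k<K. H k * ((1 - 2 powr (1 + (w + 2 * real k))) * Re (zeta (of_real (- (w + 2 * real k))))) *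
              a powr (- (w + 2 * real k)))" if a: "a > 0" for a
  proof -
    have sf: "summable (\<lambda>n. (-1) ^ n *\<^sub>R f ((real n + 1) / a))"
      using summable[OF a] by (simp add: add.commute)
    have sp: "summable (\<lambda>n. (-1) ^ n * (fdiff ^^ M) (\<lambda>x. x powr (w + 2 * real k)) (real n + 1))" if k: "k < K" for k
    proof (rule summable_comparison_test')
      have e: "w + 2 * real k - real M < -1" using M(1) k by (smt (verit) of_nat_less_iff)
      then show "summable (\<lambda>n. \<bar>falling (w + 2 * real k) M\<bar> * (real n + 1) powr (w + 2 * real k - real M))"
        by (intro summable_mult summable_real_powr_plus1)
      have "\<bar>(fdiff ^^ M) (\<lambda>x. x powr (w + 2 * real k)) (real n + 1)\<bar> \<le>
              \<bar>falling (w + 2 * real k) M\<bar> * (real n + 1) powr (w + 2 * real k - real M)" for n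
        by (rule abs_fdiff_powr_le) (use e in \<open>auto intro!: powr_mono2'\<close>)
      then show "norm ((-1) ^ n * (fdiff ^^ M) (\<lambda>x. x powr (w + 2 * real k)) (real n + 1)) \<le>
              \<bar>falling (w + 2 * real k) M\<bar> * (real n + 1) powr (w + 2 * real k - real M)" for n
        by (simp add: abs_mult)
    qed
    have "euler_sum M (?r a) = euler_sum M (\<lambda>x. f (x / a)) -
        (\<Sum>k<K. H k * a powr (- (w + 2 * real k)) * euler_sum M (\<lambda>x. x powr (w + 2 * real k)))"
      using euler_sum_eq_suminf(1)[of "\<lambda>x. f (x / a)", OF sf, of M] sp by (intro euler_sum_diff_sum) auto
    also have "euler_sum M (\<lambda>x. f (x / a)) = (\<Sum>n. (-1) ^ n * f (real (Suc n) / a))"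
      using euler_sum_eq_suminf(2)[of "\<lambda>x. f (x / a)", OF sf, of M] by (simp add: add.commute)
    also have "(\<Sum>k<K. H k * a powr (- (w + 2 * real k)) * euler_sum M (\<lambda>x. x powr (w + 2 * real k))) =
        (\<Sum>k<K. H k * ((1 - 2 powr (1 + (w + 2 * real k))) * Re (zeta (of_real (- (w + 2 * real k))))) *
              a powr (- (w + 2 * real k)))"
    proof (intro sum.cong refl)
      fix k assume "k \<in> {..<K}"
      then have "w + 2 * real k < real M - 1" using M(1) by (smt (verit) lessThan_iff of_nat_less_iff)
      from euler_sum_real_powr[OF this w]
      show "H k * a powr (- (w + 2 * real k)) * euler_sum M (\<lambda>x. x powr (w + 2 * real k)) =
        H k * ((1 - 2 powr (1 + (w + 2 * real k))) * Re (zeta (of_real (- (w + 2 * real k))))) * a powr (- (w + 2 * real k))"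
        by (simp only: mult_ac)
    qed
    finally show ?thesis .
  qed
  note eq = this
  have "(\<lambda>a. euler_sum M (?r a)) \<in> O[at_top](\<lambda>a. a powr (- (w + 2 * real K)))"
    by (rule euler_sum_remainder_bigo[OF ser B f q M])
  then show "(\<lambda>a. (\<Sum>n. (-1) ^ n * f (real (Suc n) / a)) -
           (\<Sum>k<K. H k * ((1 - 2 powr (1 + (w + 2 * real k))) * Re (zeta (of_real (- (w + 2 * real k))))) *
              a powr (- (w + 2 * real k)))) \<in> O[at_top](\<lambda>a. a powr (- (w + 2 * real K)))"
  proof (rule landau_o.big.ev_eq_trans2[where g = "\<lambda>_ y. y", rotated])
    show "eventually (\<lambda>a. (\<Sum>n. (-1) ^ n * f (real (Suc n) / a)) -
           (\<Sum>k<K. H k * ((1 - 2 powr (1 + (w + 2 * real k))) * Re (zeta (of_real (- (w + 2 * real k))))) *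
              a powr (- (w + 2 * real k))) = euler_sum M (?r a)) at_top"
    proof (rule eventually_mono)
      show "\<forall>\<^sub>F a in at_top. a > (0::real)" by (rule eventually_gt_at_top)
    qed (rule eq[symmetric])
  qed
qed

section \<open>The Bessel kernel\<close>

text \<open>
  Differentiating \<open>x^\<alpha> (1 + x^2)^(-\<beta>) J_s(b x)\<close> yields a combination of functions of the same
  form, none of which decays more slowly. The exponent does not improve either, since the
  derivatives of \<open>J_s\<close> oscillate with the same amplitude.
\<close>

lemma smooth_decay_bessel:
  assumes "b > 0" "\<beta> \<ge> 0" "\<alpha> - 2 * \<beta> - 1 / 2 \<le> q"
  shows "smooth_decay M q (\<lambda>x. x powr \<alpha> * (1 + x\<^sup>2) powr (- \<beta>) * bessel_J s (b * x))"
  using assms(2,3)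
proof (induction M arbitrary: \<alpha> \<beta> s)
  case 0
  let ?e = "\<alpha> - 2 * \<beta> - 1 / 2"
  have "\<exists>C\<ge>0. \<forall>x\<ge>d. \<bar>x powr \<alpha> * (1 + x\<^sup>2) powr (- \<beta>) * bessel_J s (b * x)\<bar> \<le> C * x powr q"
    if d: "d > 0" for d
  proof -
    from bessel_J_decay[of "b * d" s] assms(1) d obtain C where
      C: "C \<ge> 0" "\<And>y. y \<ge> b * d \<Longrightarrow> \<bar>bessel_J s y\<bar> \<le> C * y powr (- 1 / 2)" by auto
    let ?C = "C * b powr (- 1 / 2) * d powr (?e - q)"
    have "\<bar>x powr \<alpha> * (1 + x\<^sup>2) powr (- \<beta>) * bessel_J s (b * x)\<bar> \<le> ?C * x powr q" if x: "x \<ge> d" for x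
    proof -
      have x0: "x > 0" using x d by simp
      have "(1 + x\<^sup>2) powr (- \<beta>) \<le> (x\<^sup>2) powr (- \<beta>)"
        using x0 0 by (intro powr_mono2') auto
      also have "(x\<^sup>2) powr (- \<beta>) = x powr (- 2 * \<beta>)"
        using x0 by (simp add: powr_powr flip: powr_numeral)
      finally have 1: "(1 + x\<^sup>2) powr (- \<beta>) \<le> x powr (- 2 * \<beta>)" .
      have 2: "\<bar>bessel_J s (b * x)\<bar> \<le> C * (b powr (- 1 / 2) * x powr (- 1 / 2))"
        using C(2)[of "b * x"] x assms(1) x0 by (simp add: powr_mult)
      have "\<bar>x powr \<alpha> * (1 + x\<^sup>2) powr (- \<beta>) * bessel_J s (b * x)\<bar> =
            x powr \<alpha> * (1 + x\<^sup>2) powr (- \<beta>) * \<bar>bessel_J s (b * x)\<bar>"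
        by (simp add: abs_mult)
      also have "\<dots> \<le> x powr \<alpha> * x powr (- 2 * \<beta>) * (C * (b powr (- 1 / 2) * x powr (- 1 / 2)))"
        using 1 2 by (intro mult_mono) auto
      also have "\<dots> = C * b powr (- 1 / 2) * (x powr \<alpha> * x powr (- 2 * \<beta>) * x powr (- 1 / 2))"
        by (simp only: mult_ac)
      also have "x powr \<alpha> * x powr (- 2 * \<beta>) * x powr (- 1 / 2) = x powr (?e - q) * x powr q"
        by (simp add: powr_add[symmetric])
      also have "C * b powr (- 1 / 2) * (x powr (?e - q) * x powr q) \<le> C * b powr (- 1 / 2) * (d powr (?e - q) * x powr q)"
        using x d 0 C(1) by (intro mult_left_mono mult_right_mono powr_mono2') auto
      finally show ?thesis by (simp only: mult.assoc)
    qed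
    then show ?thesis using C(1) by (intro exI[of _ ?C]) auto
  qed
  then show ?case by simp
next
  case (Suc M)
  let ?T = "\<lambda>\<alpha> \<beta> s x. x powr \<alpha> * (1 + x\<^sup>2) powr (- \<beta>) * bessel_J s (b * x)"
  let ?f' = "\<lambda>x. 1 * (\<alpha> * ?T (\<alpha> - 1) \<beta> s x + (- 2 * \<beta>) * ?T (\<alpha> + 1) (\<beta> + 1) s x) +
                 1 * (b / 2 * ?T \<alpha> \<beta> (s - 1) x + (- b / 2) * ?T \<alpha> \<beta> (s + 1) x)"
  have "smooth_decay M q ?f'"
    by (intro smooth_decay_lincomb Suc.IH) (use Suc.prems in auto)
  moreover have "(?T \<alpha> \<beta> s has_real_derivative ?f' x) (at x)" if x: "x > 0" for x
  proof -
    have p: "1 + x\<^sup>2 > 0" by (simp add: add_pos_nonneg)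
    have 1: "((\<lambda>x. x powr \<alpha>) has_real_derivative \<alpha> * x powr (\<alpha> - 1)) (at x)"
      by (rule has_real_derivative_powr[OF x])
    have "((\<lambda>x. 1 + x\<^sup>2) has_real_derivative 2 * x) (at x)"
      by (auto intro!: derivative_eq_intros)
    from DERIV_chain2[OF has_real_derivative_powr[OF p, of "- \<beta>"] this]
    have 2: "((\<lambda>x. (1 + x\<^sup>2) powr (- \<beta>)) has_real_derivative
            - \<beta> * (1 + x\<^sup>2) powr (- \<beta> - 1) * (2 * x)) (at x)" .
    have 3: "((\<lambda>x. bessel_J s (b * x)) has_real_derivative
            b / 2 * bessel_J (s - 1) (b * x) - b / 2 * bessel_J (s + 1) (b * x)) (at x)"
    proof (rule DERIV_cong[OF DERIV_chain2[OF bessel_J_deriv]])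
      show "((*) b has_real_derivative b) (at x)" by (auto intro!: derivative_eq_intros)
    qed (use x assms(1) in \<open>simp_all add: field_simps\<close>)
    have e: "x powr (\<alpha> + 1) = x powr \<alpha> * x" "(1 + x\<^sup>2) powr (- (\<beta> + 1)) = (1 + x\<^sup>2) powr (- \<beta> - 1)"
      using x by (simp_all add: powr_add)
    show ?thesis
      unfolding e by (rule DERIV_cong[OF DERIV_mult[OF DERIV_mult[OF 1 2] 3]]) (simp add: algebra_simps)
  qed
  ultimately show ?case
    unfolding smooth_decay.simps by (intro exI[of _ ?f'] conjI allI impI)
qed

text \<open>
  The Taylor coefficients of \<open>(1 + y)^(-\<mu>) bessel_entire \<nu> (z y)\<close> in \<open>y\<close>, as a Cauchy product with the
  binomial series.
\<close>

definition product_coeff :: "real \<Rightarrow> real \<Rightarrow> real \<Rightarrow> nat \<Rightarrow> real" where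
  "product_coeff \<mu> \<nu> z k = (\<Sum>j\<le>k. (bessel_coeff \<nu> j * z ^ j) * (- \<mu> gchoose (k - j)))"

lemma product_coeff_sums:
  assumes "\<bar>y\<bar> < 1"
  shows "(\<lambda>k. product_coeff \<mu> \<nu> z k * y ^ k) sums (bessel_entire \<nu> (z * y) * (1 + y) powr (- \<mu>))"
proof -
  have a: "summable (\<lambda>k. norm (bessel_coeff \<nu> k * (z * y) ^ k))"
    unfolding real_norm_def by (rule summable_abs_bessel)
  have "(\<lambda>k. (- \<mu> gchoose k) * ((\<bar>y\<bar> + 1) / 2) ^ k) sums (1 + (\<bar>y\<bar> + 1) / 2) powr (- \<mu>)"
    using assms by (intro gen_binomial_real) auto
  then have b: "summable (\<lambda>k. norm ((- \<mu> gchoose k) * y ^ k))"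
    using assms by (intro powser_insidea[of _ "(\<bar>y\<bar> + 1) / 2"]) (auto simp: sums_iff)
  have "(\<lambda>k. \<Sum>i\<le>k. bessel_coeff \<nu> i * (z * y) ^ i * ((- \<mu> gchoose (k - i)) * y ^ (k - i))) sums
     ((\<Sum>k. bessel_coeff \<nu> k * (z * y) ^ k) * (\<Sum>k. (- \<mu> gchoose k) * y ^ k))"
    by (rule Cauchy_product_sums[OF a b])
  also have "(\<Sum>k. (- \<mu> gchoose k) * y ^ k) = (1 + y) powr (- \<mu>)"
    using gen_binomial_real[OF assms] by (simp add: sums_iff)
  also have "(\<Sum>k. bessel_coeff \<nu> k * (z * y) ^ k) = bessel_entire \<nu> (z * y)"
    by (simp add: bessel_entire_def)
  also have "(\<lambda>k. \<Sum>i\<le>k. bessel_coeff \<nu> i * (z * y) ^ i * ((- \<mu> gchoose (k - i)) * y ^ (k - i))) =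
     (\<lambda>k. product_coeff \<mu> \<nu> z k * y ^ k)"
  proof
    fix k
    have "bessel_coeff \<nu> i * (z * y) ^ i * ((- \<mu> gchoose (k - i)) * y ^ (k - i)) =
          bessel_coeff \<nu> i * z ^ i * (- \<mu> gchoose (k - i)) * y ^ k" if "i \<le> k" for i
      using that power_add[of y i "k - i"] by (simp add: power_mult_distrib mult_ac)
    then show "(\<Sum>i\<le>k. bessel_coeff \<nu> i * (z * y) ^ i * ((- \<mu> gchoose (k - i)) * y ^ (k - i))) =
      product_coeff \<mu> \<nu> z k * y ^ k"
      unfolding product_coeff_def sum_distrib_right by (intro sum.cong) auto
  qed
  finally show ?thesis .
qed

text \<open>
  The series has radius of convergence at least 1, so its terms at \<open>1/2\<close> are bounded.
\<close>

lemma product_coeff_bound: "\<exists>B. \<forall>k. \<bar>product_coeff \<mu> \<nu> z k\<bar> \<le> B * 2 ^ k"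
proof -
  have "summable (\<lambda>k. product_coeff \<mu> \<nu> z k * (1 / 2) ^ k)"
    using product_coeff_sums[of "1 / 2" \<mu> \<nu> z] by (auto simp: sums_iff)
  then have "Bseq (\<lambda>k. product_coeff \<mu> \<nu> z k * (1 / 2) ^ k)"
    using summable_LIMSEQ_zero convergent_def convergent_imp_Bseq by blast
  then obtain B where B: "\<And>k. norm (product_coeff \<mu> \<nu> z k * (1 / 2) ^ k) \<le> B" unfolding Bseq_def by blast
  have "\<bar>product_coeff \<mu> \<nu> z k\<bar> \<le> B * 2 ^ k" for k
    using B[of k] by (simp add: abs_mult power_one_over divide_le_eq)
  then show ?thesis by blast
qed

text \<open>
  Away from the negative integers \<open>\<Gamma>(1+\<nu>) (1+\<nu>)_j = \<Gamma>(1+\<nu>+j)\<close>, so both branches of the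
  definition are the same sum.
\<close>

lemma F_div_Gamma_eq:
  "F_div_Gamma \<mu> \<nu> z k =
     (\<Sum>j\<le>k. pochhammer (- real k) j / pochhammer (1 - \<mu> - real k) j * rGamma (1 + \<nu> + real j) * (z ^ j / fact j))"
proof (cases "\<nu> \<in> \<int> \<and> \<nu> < 0")
  case False
  have nz: "pochhammer (1 + \<nu>) j \<noteq> 0" for j
  proof
    assume "pochhammer (1 + \<nu>) j = 0"
    then obtain i :: nat where "1 + \<nu> = - real i" by (auto simp: pochhammer_eq_0_iff)
    then have "\<nu> = of_int (- 1 - int i)" "\<nu> < 0" by auto
    with False show False by (metis Ints_of_int)
  qed
  have "rGamma (1 + \<nu> + real j) = rGamma (1 + \<nu>) / pochhammer (1 + \<nu>) j" for j
    using pochhammer_rGamma[of "1 + \<nu>" j] nz[of j] by (simp add: field_simps)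
  then show ?thesis
    unfolding F_div_Gamma_def F_def if_not_P[OF False] sum_divide_distrib
    by (intro sum.cong) (simp_all add: rGamma_inverse_Gamma field_simps)
qed (simp add: F_div_Gamma_def)

lemma pochhammer_quotient:
  assumes "j \<le> k"
  shows "pochhammer (1 - x - real k) j = (- 1) ^ j * pochhammer (x + real (k - j)) j"
proof -
  have "1 - x - real k = - (x + real k - 1)" "x + real (k - j) = x + real k - 1 - real j + 1"
    using assms by (simp_all add: of_nat_diff)
  then show ?thesis by (simp only: pochhammer_minus)
qed

text \<open>
  The quotient \<open>(-k)_j / (1-\<mu>-k)_j\<close> is \<open>k! (\<mu>)_(k-j) / ((k-j)! (\<mu>)_k)\<close>: multiplied by \<open>(\<mu>)_k/k!\<close> it is
  up to sign the binomial coefficient that enters the Cauchy product.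
\<close>

lemma product_coeff_eq:
  assumes "\<mu> > 0"
  shows "product_coeff \<mu> \<nu> z k = (- 1) ^ k * pochhammer \<mu> k / fact k * F_div_Gamma \<mu> \<nu> z k"
  unfolding product_coeff_def F_div_Gamma_eq sum_distrib_left
proof (intro sum.cong refl)
  fix j assume "j \<in> {..k}"
  then have j: "j \<le> k" by simp
  have pos: "pochhammer \<mu> m > 0" "pochhammer (\<mu> + real (k - j)) m > 0" for m
    using assms by (intro pochhammer_pos; simp)+
  have 1: "pochhammer (- real k) j = (- 1) ^ j * (fact k / fact (k - j))"
  proof -
    have "fact k = fact (k - j) * pochhammer (1 + real (k - j)) j"
      using pochhammer_product[of "k - j" k "1::real"] j by (simp add: pochhammer_fact)
    then show ?thesis using pochhammer_quotient[OF j, of 1] by simp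
  qed
  have 2: "pochhammer \<mu> k = pochhammer \<mu> (k - j) * pochhammer (\<mu> + real (k - j)) j"
    using pochhammer_product[of "k - j" k \<mu>] j by simp
  have 3: "(- \<mu> gchoose (k - j)) = (- 1) ^ (k - j) * pochhammer \<mu> (k - j) / fact (k - j)"
    by (simp add: gbinomial_pochhammer)
  have sgn: "(- 1 :: real) ^ k = (- 1) ^ j * (- 1) ^ (k - j)"
    using j by (simp add: power_add[symmetric])
  have one: "(- 1 :: real) ^ j * (- 1) ^ j = 1" by (simp add: power_mult_distrib[symmetric])
  show "bessel_coeff \<nu> j * z ^ j * (- \<mu> gchoose (k - j)) = (- 1) ^ k * pochhammer \<mu> k / fact k *
      (pochhammer (- real k) j / pochhammer (1 - \<mu> - real k) j * rGamma (1 + \<nu> + real j) * (z ^ j / fact j))"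
    unfolding 1 2 3 sgn pochhammer_quotient[OF j] bessel_coeff_def
    using pos(2)[of j] by (simp add: field_simps add_ac)
qed

lemma bessel_kernel_sums:
  assumes "b > 0" "0 < x" "x < 1"
  shows "(\<lambda>k. (b / 2) powr \<nu> * product_coeff \<mu> \<nu> (b\<^sup>2 / 4) k * x powr (\<gamma> + \<nu> + 2 * real k)) sums
     (x powr \<gamma> * (1 + x\<^sup>2) powr (- \<mu>) * bessel_J \<nu> (b * x))"
proof -
  have "\<bar>x\<^sup>2\<bar> < 1" using assms by (simp add: power_less_one_iff)
  from sums_mult[OF product_coeff_sums[OF this, of \<mu> \<nu> "b\<^sup>2 / 4"], of "(b / 2) powr \<nu> * x powr (\<gamma> + \<nu>)"]
  have "(\<lambda>k. (b / 2) powr \<nu> * x powr (\<gamma> + \<nu>) * (product_coeff \<mu> \<nu> (b\<^sup>2 / 4) k * (x\<^sup>2) ^ k)) sums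
     ((b / 2) powr \<nu> * x powr (\<gamma> + \<nu>) * (bessel_entire \<nu> (b\<^sup>2 / 4 * x\<^sup>2) * (1 + x\<^sup>2) powr (- \<mu>)))" .
  also have "(\<lambda>k. (b / 2) powr \<nu> * x powr (\<gamma> + \<nu>) * (product_coeff \<mu> \<nu> (b\<^sup>2 / 4) k * (x\<^sup>2) ^ k)) =
     (\<lambda>k. (b / 2) powr \<nu> * product_coeff \<mu> \<nu> (b\<^sup>2 / 4) k * x powr (\<gamma> + \<nu> + 2 * real k))"
  proof
    fix k
    have "x powr (2 * real k) = (x\<^sup>2) ^ k"
      using assms powr_realpow[of x "2 * k"] by (simp add: power_mult)
    then show "(b / 2) powr \<nu> * x powr (\<gamma> + \<nu>) * (product_coeff \<mu> \<nu> (b\<^sup>2 / 4) k * (x\<^sup>2) ^ k) =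
      (b / 2) powr \<nu> * product_coeff \<mu> \<nu> (b\<^sup>2 / 4) k * x powr (\<gamma> + \<nu> + 2 * real k)"
      by (simp only: powr_add[of x "\<gamma> + \<nu>"] mult_ac)
  qed
  also have "(b / 2) powr \<nu> * x powr (\<gamma> + \<nu>) * (bessel_entire \<nu> (b\<^sup>2 / 4 * x\<^sup>2) * (1 + x\<^sup>2) powr (- \<mu>)) =
     x powr \<gamma> * (1 + x\<^sup>2) powr (- \<mu>) * ((b / 2 * x) powr \<nu> * bessel_entire \<nu> (b\<^sup>2 / 4 * x\<^sup>2))"
    by (simp only: powr_add powr_mult mult_ac)
  also have "(b / 2 * x) powr \<nu> * bessel_entire \<nu> (b\<^sup>2 / 4 * x\<^sup>2) = bessel_J \<nu> (b * x)"
    using assms by (simp add: bessel_J_eq power_mult_distrib)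
  finally show ?thesis .
qed

theorem mainTheorem4:
  fixes b \<mu> \<gamma> \<nu> :: real
  defines "\<omega> \<equiv> \<lambda>k::nat. \<gamma> + \<nu> + 2 * real k"
  defines "t \<equiv> \<lambda>(a::real) (n::nat).
             (-1) ^ (n - 1) * real n powr \<gamma> / ((real n)\<^sup>2 + a\<^sup>2) powr \<mu> *
             bessel_J \<nu> (real n * b / a)"
  assumes "b > 0" and "\<mu> > 0"
    and "2 * \<mu> - \<gamma> > 1 / 2"
    and "\<gamma> + \<nu> \<notin> {- (2 * real m + 1) | m::nat. True}"
  shows "(\<forall>a>0. summable (\<lambda>n. t a (Suc n))) \<and>
         (\<forall>K::nat.
           (\<lambda>a. (\<Sum>n. t a (Suc n)) -
                a powr (- \<nu> - 2 * \<mu>) * (b / 2) powr \<nu> *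
                (\<Sum>k<K. (-1) ^ k * pochhammer \<mu> k / fact k *
                        Re (zeta (of_real (- \<omega> k))) * F_div_Gamma \<mu> \<nu> (b\<^sup>2 / 4) k *
                        (1 - 2 powr (1 + \<omega> k)) * a powr (- 2 * real k)))
           \<in> O[at_top](\<lambda>a. a powr (- \<nu> - 2 * \<mu> - 2 * real K)))"
proof -
  define f where "f x = x powr \<gamma> * (1 + x\<^sup>2) powr (- \<mu>) * bessel_J \<nu> (b * x)" for x
  define H where "H k = (b / 2) powr \<nu> * product_coeff \<mu> \<nu> (b\<^sup>2 / 4) k" for k
  define S where "S a = (\<Sum>n. (-1) ^ n * f (real (Suc n) / a))" for a
  define G where "G K a = (\<Sum>k<K. H k * ((1 - 2 powr (1 + \<omega> k)) * Re (zeta (of_real (- \<omega> k)))) * a powr (- \<omega> k))" for K a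
  have ser: "(\<lambda>k. H k * x powr (\<gamma> + \<nu> + 2 * real k)) sums f x" if "0 < x" "x < 1" for x
    unfolding H_def f_def by (rule bessel_kernel_sums[OF assms(3) that])
  obtain B where B: "\<And>k. \<bar>product_coeff \<mu> \<nu> (b\<^sup>2 / 4) k\<bar> \<le> B * 2 ^ k"
    using product_coeff_bound by blast
  have HB: "\<bar>H k\<bar> \<le> ((b / 2) powr \<nu> * B) * 2 ^ k" for k
    unfolding H_def abs_mult using mult_left_mono[OF B[of k], of "(b / 2) powr \<nu>"] by (simp add: mult.assoc)
  have sd: "smooth_decay M (\<gamma> - 2 * \<mu> - 1 / 2) f" for M
    unfolding f_def by (rule smooth_decay_bessel) (use assms in auto)
  have q: "\<gamma> - 2 * \<mu> - 1 / 2 < - 1" using assms(5) by simp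
  have w: "\<gamma> + \<nu> + 2 * real k \<noteq> - 1" for k
  proof
    assume "\<gamma> + \<nu> + 2 * real k = - 1"
    then have "\<gamma> + \<nu> = - (2 * real k + 1)" by simp
    with assms(6) show False by blast
  qed
  have summable: "summable (\<lambda>n. (-1) ^ n * f (real (Suc n) / a))" if "a > 0" for a
    by (rule alternating_sum_expansion(1)[OF ser HB sd q w that])
  have expansion: "(\<lambda>a. S a - G K a) \<in> O[at_top](\<lambda>a. a powr (- \<omega> K))" for K
    unfolding S_def G_def \<omega>_def by (rule alternating_sum_expansion(2)[OF ser HB sd q w])
  have t_eq: "t a (Suc n) = a powr (\<gamma> - 2 * \<mu>) * ((-1) ^ n * f (real (Suc n) / a))" if a: "a > 0" for a n
  proof -
    define N where "N = real (Suc n)"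
    have N: "N > 0" by (simp add: N_def)
    have "N\<^sup>2 + a\<^sup>2 = a\<^sup>2 * (1 + (N / a)\<^sup>2)" using a by (simp add: field_simps power_divide)
    then have "(N\<^sup>2 + a\<^sup>2) powr \<mu> = (a\<^sup>2) powr \<mu> * (1 + (N / a)\<^sup>2) powr \<mu>" by (simp only: powr_mult)
    moreover have "(a\<^sup>2) powr \<mu> = a powr (2 * \<mu>)"
      using a by (simp add: powr_powr flip: powr_numeral)
    moreover have "(N / a) powr \<gamma> = N powr \<gamma> / a powr \<gamma>" by (rule powr_divide)
    moreover have "1 + (N / a)\<^sup>2 > 0" by (intro add_pos_nonneg) auto
    then have "(1 + (N / a)\<^sup>2) powr \<mu> > 0" by simp
    ultimately show ?thesis
      unfolding t_def f_def N_def[symmetric] using a by (simp add: powr_minus powr_diff field_simps)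
  qed
  have sum_eq: "(\<Sum>n. t a (Suc n)) = a powr (\<gamma> - 2 * \<mu>) * S a" if "a > 0" for a
    unfolding t_eq[OF that] S_def by (rule suminf_mult[OF summable[OF that]])
  have main_eq: "a powr (- \<nu> - 2 * \<mu>) * (b / 2) powr \<nu> *
       (\<Sum>k<K. (-1) ^ k * pochhammer \<mu> k / fact k *
               Re (zeta (of_real (- \<omega> k))) * F_div_Gamma \<mu> \<nu> (b\<^sup>2 / 4) k *
               (1 - 2 powr (1 + \<omega> k)) * a powr (- 2 * real k)) = a powr (\<gamma> - 2 * \<mu>) * G K a" for a K
    unfolding G_def sum_distrib_left
  proof (intro sum.cong refl)
    fix k
    have "a powr (- \<nu> - 2 * \<mu>) * a powr (- 2 * real k) = a powr (\<gamma> - 2 * \<mu>) * a powr (- \<omega> k)"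
    proof -
      have "- \<nu> - 2 * \<mu> + - 2 * real k = \<gamma> - 2 * \<mu> + - \<omega> k" by (simp add: \<omega>_def)
      then show ?thesis by (simp only: powr_add[symmetric])
    qed
    note eq = this
    have alg: "x * y * (c * z * f * d * e) = (x * e) * (y * (c * f) * (d * z))" for x y c z f d e :: real
      by (simp only: mult_ac)
    show "a powr (- \<nu> - 2 * \<mu>) * (b / 2) powr \<nu> * ((-1) ^ k * pochhammer \<mu> k / fact k *
               Re (zeta (of_real (- \<omega> k))) * F_div_Gamma \<mu> \<nu> (b\<^sup>2 / 4) k *
               (1 - 2 powr (1 + \<omega> k)) * a powr (- 2 * real k)) =
          a powr (\<gamma> - 2 * \<mu>) * (H k * ((1 - 2 powr (1 + \<omega> k)) * Re (zeta (of_real (- \<omega> k)))) * a powr (- \<omega> k))"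
      unfolding H_def product_coeff_eq[OF assms(4)] alg eq by (simp only: mult_ac)
  qed
  show ?thesis
  proof (intro conjI allI impI)
    show "summable (\<lambda>n. t a (Suc n))" if "a > 0" for a
      unfolding t_eq[OF that] by (rule summable_mult[OF summable[OF that]])
    fix K
    have "(\<lambda>a. a powr (\<gamma> - 2 * \<mu>) * (S a - G K a)) \<in> O[at_top](\<lambda>a. a powr (\<gamma> - 2 * \<mu>) * a powr (- \<omega> K))"
      by (rule landau_o.big.mult[OF landau_o.big_refl expansion])
    also have "(\<lambda>a. a powr (\<gamma> - 2 * \<mu>) * a powr (- \<omega> K)) = (\<lambda>a. a powr (- \<nu> - 2 * \<mu> - 2 * real K))"
    proof -
      have "\<gamma> - 2 * \<mu> + - \<omega> K = - \<nu> - 2 * \<mu> - 2 * real K" by (simp add: \<omega>_def)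
      then show ?thesis by (simp only: powr_add[symmetric])
    qed
    finally have "(\<lambda>a. a powr (\<gamma> - 2 * \<mu>) * (S a - G K a)) \<in> O[at_top](\<lambda>a. a powr (- \<nu> - 2 * \<mu> - 2 * real K))" .
    then show "(\<lambda>a. (\<Sum>n. t a (Suc n)) -
                a powr (- \<nu> - 2 * \<mu>) * (b / 2) powr \<nu> *
                (\<Sum>k<K. (-1) ^ k * pochhammer \<mu> k / fact k *
                        Re (zeta (of_real (- \<omega> k))) * F_div_Gamma \<mu> \<nu> (b\<^sup>2 / 4) k *
                        (1 - 2 powr (1 + \<omega> k)) * a powr (- 2 * real k)))
           \<in> O[at_top](\<lambda>a. a powr (- \<nu> - 2 * \<mu> - 2 * real K))"
    proof (rule landau_o.big.ev_eq_trans2[where g = "\<lambda>_ y. y", rotated])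
      show "eventually (\<lambda>a. (\<Sum>n. t a (Suc n)) -
                a powr (- \<nu> - 2 * \<mu>) * (b / 2) powr \<nu> *
                (\<Sum>k<K. (-1) ^ k * pochhammer \<mu> k / fact k *
                        Re (zeta (of_real (- \<omega> k))) * F_div_Gamma \<mu> \<nu> (b\<^sup>2 / 4) k *
                        (1 - 2 powr (1 + \<omega> k)) * a powr (- 2 * real k)) =
              a powr (\<gamma> - 2 * \<mu>) * (S a - G K a)) at_top"
      proof (rule eventually_mono)
        show "\<forall>\<^sub>F a in at_top. a > (0::real)" by (rule eventually_gt_at_top)
      next
        fix a :: real assume "a > 0"
        then show "(\<Sum>n. t a (Suc n)) -
                a powr (- \<nu> - 2 * \<mu>) * (b / 2) powr \<nu> *
                (\<Sum>k<K. (-1) ^ k * pochhammer \<mu> k / fact k *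
                        Re (zeta (of_real (- \<omega> k))) * F_div_Gamma \<mu> \<nu> (b\<^sup>2 / 4) k *
                        (1 - 2 powr (1 + \<omega> k)) * a powr (- 2 * real k)) =
              a powr (\<gamma> - 2 * \<mu>) * (S a - G K a)"
          unfolding main_eq right_diff_distrib[of "a powr (\<gamma> - 2 * \<mu>)"] by (simp only: sum_eq)
      qed
    qed
  qed
qed

end
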